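(* For any integer $\ell\ge 2$ and any real $x>0$, as $n\to\infty$, \[ \ln \mathcal{H}_{\ell,n}(x)\sim \frac{\ell}{\ell-1}\,(x\mathcal{K}_{\ell})^{\frac{1}{\ell}}\, n^{\frac{\ell-1}{\ell}}, \] where $\mathcal{K}_{\ell}=(\ell-1)!\,\zeta(2)\zeta(3)\cdots\zeta(\ell)$.
   Context: Let $[n]=\{1,\dots,n\}$ and let $\mathfrak{S}_n$ be the symmetric group on $[n]$. Let \[ \mathcal{C}_{\ell,n}=\{(\sigma_1,\dots,\sigma_\ell)\in\mathfrak{S}_n^{\ell}\ :\ \sigma_i\sigma_j=\sigma_j\sigma_i \text{ for all } i,j\}. \] For $(\sigma_1,\dots,\sigma_\ell)\in\mathcal{C}_{\ell,n}$, let $\kappa_{\ell,n}(\sigma_1,\dots,\sigma_\ell)$ be the number of orbits of the subgroup $\langle\sigma_1,\dots,\sigma_\ell\rangle$ acting on $[n]$. Let $A(\ell,n,k)$ be the number of tuples in $\mathcal{C}_{\ell,n}$ with $\kappa_{\ell,n}=k$, and let \[ \mathcal{H}_{\ell,n}(x)=\frac{1}{n!}\sum_{k=0}^{n}A(\ell,n,k)\,x^k . \] Here $\zeta$ is the Riemann zeta function, and $f(n)\sim g(n)$ means $f(n)/g(n)\to 1$ as $n\to\infty$. *)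

theory Defs
  imports
    Complex_Main
    "HOL-Library.FuncSet"
    "HOL-Library.Landau_Symbols"
    "HOL-Algebra.Sym_Groups"
    "HOL-Algebra.Group_Action"
begin

(* An l-tuple of permutations of {1..n} is an extensional function on the index set {1..l}. *)
definition commuting_tuples :: "nat \<Rightarrow> nat \<Rightarrow> (nat \<Rightarrow> nat \<Rightarrow> nat) set" where
  "commuting_tuples l n =
     {\<sigma> \<in> {1..l} \<rightarrow>\<^sub>E carrier (sym_group n).
        \<forall>i\<in>{1..l}. \<forall>j\<in>{1..l}. \<sigma> i \<otimes>\<^bsub>sym_group n\<^esub> \<sigma> j = \<sigma> j \<otimes>\<^bsub>sym_group n\<^esub> \<sigma> i}"

definition tuple_subgroup :: "nat \<Rightarrow> nat \<Rightarrow> (nat \<Rightarrow> nat \<Rightarrow> nat) \<Rightarrow> (nat \<Rightarrow> nat) monoid" where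
  "tuple_subgroup l n \<sigma> = (sym_group n)\<lparr>carrier := generate (sym_group n) (\<sigma> ` {1..l})\<rparr>"

(* Elements of sym_group n are total functions nat => nat fixing everything outside {1..n}.
   The natural action on {1..n} is written with restrict because group_action asks for
   a homomorphism into BijGroup {1..n}, whose elements are extensional on {1..n}. *)
definition kappa :: "nat \<Rightarrow> nat \<Rightarrow> (nat \<Rightarrow> nat \<Rightarrow> nat) \<Rightarrow> nat" where
  "kappa l n \<sigma> = card (orbits (tuple_subgroup l n \<sigma>) {1..n} (\<lambda>g. restrict g {1..n}))"

definition commuting_count :: "nat \<Rightarrow> nat \<Rightarrow> nat \<Rightarrow> nat" where
  "commuting_count l n k = card {\<sigma> \<in> commuting_tuples l n. kappa l n \<sigma> = k}"

definition orbit_poly :: "nat \<Rightarrow> nat \<Rightarrow> real \<Rightarrow> real" where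
  "orbit_poly l n x = 1 / fact n * (\<Sum>k=0..n. real (commuting_count l n k) * x ^ k)"

(* The Riemann zeta function on real arguments s > 1, where it is given by its Dirichlet series;
   for other s the series diverges and the value is meaningless. *)
definition riemann_zeta :: "real \<Rightarrow> real" where
  "riemann_zeta s = (\<Sum>m. 1 / real (Suc m) powr s)"

definition K_const :: "nat \<Rightarrow> real" where
  "K_const l = fact (l - 1) * (\<Prod>j=2..l. riemann_zeta (real j))"

end

theory Submission
  imports Defs "HOL-Analysis.Analysis" "HOL-Real_Asymp.Real_Asymp"
begin

text \<open>Splitting off the orbit of one point of \<open>[n]\<close> gives the recurrence
  \<open>n H(n) = x (\<Sum>k=1..n. s(k) H(n-k))\<close>, where \<open>(k-1)! s(k)\<close> counts the transitive commuting
  \<open>l\<close>-tuples on \<open>k\<close> points, so that \<open>s(k)\<close> is the number of subgroups of index \<open>k\<close> in \<open>\<int>\<^sup>l\<close>.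
  In a transitive \<open>(l+1)\<close>-tuple the last permutation cycles the orbits of the first \<open>l\<close>; this
  yields \<open>s\<^sub>l\<^sub>+\<^sub>1(m) = (\<Sum>k dvd m. k s\<^sub>l(k))\<close>, and by dominated convergence
  \<open>t\<^sup>l (\<Sum>k. s\<^sub>l(k) exp (-t k))\<close> tends to \<open>K\<^sub>l\<close> as \<open>t\<close> decreases to 0.
  As in Erdos' elementary treatment of the partition function, bounds \<open>D exp (c n\<^sup>\<beta>)\<close>
  with \<open>\<beta> = (l-1)/l\<close> propagate through the recurrence: by concavity
  \<open>(n-k)\<^sup>\<beta>\<close> is close to \<open>n\<^sup>\<beta> - \<beta> k n\<^sup>\<beta>\<^sup>-\<^sup>1\<close>, so the induction step compares \<open>x K\<^sub>l / (c \<beta>)\<^sup>l\<close> with 1,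
  and the threshold for \<open>c\<close> is the claimed constant.\<close>

subsection \<open>Commuting families and their orbits\<close>

text \<open>The exponent \<beta> is forced: the induction step compares x times the Abel sum at t =
  c \<beta> n^(\<beta>-1) with n, and as the Abel sum grows like K_l t^(-l), both sides have the
  same order only if l (1-\<beta>) = 1. The critical c solves (c \<beta>)^l = x K_l, which is where
  the factor l/(l-1) = 1/\<beta> comes from. Concavity helps in one direction only: the upper bound
  is direct, while the lower one has to give up a factor in the slope and to cut off large k. The
  divisor recursion carries the weight k, so an induction on l alone does not close: the Abel sum
  for l+1 needs that of k s_l(k). All weights k^j are therefore carried along; each step lowers j by
  one and contributes one zeta value, and (l-1)! is left over from the starting series of k^(l-1).
  In the counting part, the cycle of blocks need not close up by the identity: the last permutation
  returns to the first block with a twist from a centralizer. Blocks are removed one at a time, so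
  that the twist is met only when a single block is left.\<close>

text \<open>Families are padded with \<open>id\<close> outside \<open>I\<close>, so that no index ever has to be restricted to \<open>I\<close>.\<close>

definition comm_families :: "'i set \<Rightarrow> 'a set \<Rightarrow> ('i \<Rightarrow> 'a \<Rightarrow> 'a) set" where
  "comm_families I V =
     {\<sigma>. (\<forall>i. \<sigma> i permutes V) \<and> (\<forall>i. i \<notin> I \<longrightarrow> \<sigma> i = id) \<and> (\<forall>i j a. \<sigma> i (\<sigma> j a) = \<sigma> j (\<sigma> i a))}"

text \<open>Only forward steps are needed: on a finite set, inverses of permutations are powers.\<close>

inductive_set orb :: "('i \<Rightarrow> 'a \<Rightarrow> 'a) \<Rightarrow> 'a \<Rightarrow> 'a set" for \<sigma> v where
  orb_base: "v \<in> orb \<sigma> v"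
| orb_step: "a \<in> orb \<sigma> v \<Longrightarrow> \<sigma> i a \<in> orb \<sigma> v"

text \<open>One base point suffices: by \<open>orb_eq\<close>, the orbit of every other point of a
  finite \<open>V\<close> is then \<open>V\<close> as well.\<close>

definition trans_families :: "'i set \<Rightarrow> 'a set \<Rightarrow> 'a \<Rightarrow> ('i \<Rightarrow> 'a \<Rightarrow> 'a) set" where
  "trans_families I V v = {\<sigma> \<in> comm_families I V. orb \<sigma> v = V}"

lemma comm_familiesD:
  assumes "\<sigma> \<in> comm_families I V"
  shows "\<sigma> i permutes V" "i \<notin> I \<Longrightarrow> \<sigma> i = id" "\<sigma> i (\<sigma> j a) = \<sigma> j (\<sigma> i a)"
  using assms by (auto simp: comm_families_def)

lemma finite_comm_families:
  assumes "finite I" "finite V"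
  shows "finite (comm_families I V)"
proof (rule finite_subset)
  show "comm_families I V \<subseteq>
      {\<sigma>. \<forall>i. (i \<in> I \<longrightarrow> \<sigma> i \<in> {p. p permutes V}) \<and> (i \<notin> I \<longrightarrow> \<sigma> i = id)}"
    by (auto simp: comm_families_def)
  show "finite \<dots>"
    by (rule finite_set_of_finite_funs) (use assms finite_permutations in auto)
qed

lemma orb_least:
  assumes "v \<in> S" "\<And>i a. a \<in> S \<Longrightarrow> \<sigma> i a \<in> S"
  shows "orb \<sigma> v \<subseteq> S"
proof
  fix a assume "a \<in> orb \<sigma> v" thus "a \<in> S" by induction (use assms in auto)
qed

lemma orb_trans:
  assumes "a \<in> orb \<sigma> v" shows "orb \<sigma> a \<subseteq> orb \<sigma> v"
  using assms by (intro orb_least orb_step)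

text \<open>An orbit depends only on the values taken along it. This transfers orbits between a
  family, its restrictions and its gluings.\<close>

lemma orb_cong:
  assumes "\<And>i a. a \<in> orb \<sigma> v \<Longrightarrow> \<rho> i a = \<sigma> i a"
  shows "orb \<rho> v = orb \<sigma> v"
proof
  show 1: "orb \<rho> v \<subseteq> orb \<sigma> v"
    by (rule orb_least) (auto simp: assms intro: orb_base orb_step)
  show "orb \<sigma> v \<subseteq> orb \<rho> v"
  proof
    fix a assume "a \<in> orb \<sigma> v" thus "a \<in> orb \<rho> v"
      by induction (metis assms orb_base, metis assms orb_step)
  qed
qed

lemma orb_subset_carrier:
  assumes "\<And>i. \<sigma> i permutes V" "v \<in> V"
  shows "orb \<sigma> v \<subseteq> V"
  using assms by (intro orb_least) (auto simp: permutes_in_image)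

lemma permutes_image_eq:
  assumes "p permutes V" "finite B" "\<And>a. a \<in> B \<Longrightarrow> p a \<in> B"
  shows "p ` B = B"
  using assms by (intro card_subset_eq) (auto intro!: card_image permutes_inj_on)

lemma permutes_invariant_iff:
  assumes "p permutes V" "finite B" "\<And>a. a \<in> B \<Longrightarrow> p a \<in> B"
  shows "p a \<in> B \<longleftrightarrow> a \<in> B"
  using permutes_image_eq[OF assms] permutes_inj[OF assms(1)]
  by (metis inj_image_mem_iff)

text \<open>Forward steps can be reversed: \<open>orb \<sigma> (\<sigma> i a)\<close> is finite and
  closed under the injective map \<open>\<sigma> i\<close>, so it contains the preimage
  \<open>a\<close>.\<close>

lemma orb_eq:
  assumes "\<And>i. \<sigma> i permutes V" "finite V" "v \<in> V" "a \<in> orb \<sigma> v"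
  shows "orb \<sigma> a = orb \<sigma> v"
proof
  show "orb \<sigma> a \<subseteq> orb \<sigma> v" by (rule orb_trans) fact
  from assms(4) have "v \<in> orb \<sigma> a \<and> a \<in> V"
  proof induction
    case orb_base
    show ?case using assms orb.orb_base by auto
  next
    case (orb_step a i)
    have sub: "orb \<sigma> (\<sigma> i a) \<subseteq> V"
      by (rule orb_subset_carrier) (use assms orb_step in \<open>auto simp: permutes_in_image\<close>)
    hence "a \<in> orb \<sigma> (\<sigma> i a)"
      using permutes_invariant_iff[of "\<sigma> i" V "orb \<sigma> (\<sigma> i a)" a] assms
      by (auto intro: orb.intros finite_subset)
    hence "orb \<sigma> a \<subseteq> orb \<sigma> (\<sigma> i a)" by (rule orb_trans)
    thus ?case using orb_step assms by (auto simp: permutes_in_image)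
  qed
  thus "orb \<sigma> v \<subseteq> orb \<sigma> a" by (intro orb_trans) auto
qed

lemma orb_image:
  assumes "\<And>i a. p (\<sigma> i a) = \<sigma> i (p a)"
  shows "p ` orb \<sigma> v = orb \<sigma> (p v)"
proof
  have "p a \<in> orb \<sigma> (p v)" if "a \<in> orb \<sigma> v" for a
    using that by induction (auto simp: assms intro: orb.intros)
  thus "p ` orb \<sigma> v \<subseteq> orb \<sigma> (p v)" by blast
  show "orb \<sigma> (p v) \<subseteq> p ` orb \<sigma> v"
  proof (rule orb_least)
    fix i a assume "a \<in> p ` orb \<sigma> v"
    then obtain b where "b \<in> orb \<sigma> v" "a = p b" by blast
    thus "\<sigma> i a \<in> p ` orb \<sigma> v" by (metis assms image_eqI orb_step)
  qed (simp add: orb_base)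
qed

section \<open>Splitting a family along an invariant set\<close>

lemma permutes_restrict:
  assumes "p permutes V" "finite B" "\<And>a. a \<in> B \<Longrightarrow> p a \<in> B"
  shows "restrict_id p B permutes B"
  using permutes_image_eq[OF assms] permutes_inj_on[OF assms(1)]
  by (intro permutes_restrict_id) (auto simp: bij_betw_def)

lemma comm_families_restrict:
  assumes \<sigma>: "\<sigma> \<in> comm_families I V" and B: "finite B" "\<And>i a. a \<in> B \<Longrightarrow> \<sigma> i a \<in> B"
  shows "(\<lambda>i. restrict_id (\<sigma> i) B) \<in> comm_families I B"
  using permutes_restrict[OF comm_familiesD(1)[OF \<sigma>] B] comm_familiesD[OF \<sigma>] B
  by (auto simp: comm_families_def restrict_id_def fun_eq_iff)

text \<open>The supports are disjoint, so each composite acts as \<open>\<tau> i\<close> on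
  \<open>B\<close> and as \<open>\<rho> i\<close> on \<open>C\<close>, and commutation can be
  checked on each piece separately.\<close>

lemma comm_families_glue:
  assumes \<tau>: "\<tau> \<in> comm_families I B" and \<rho>: "\<rho> \<in> comm_families I C"
    and disj: "B \<inter> C = {}" and V: "V = B \<union> C"
  shows "(\<lambda>i. \<tau> i \<circ> \<rho> i) \<in> comm_families I V"
    and "a \<in> B \<Longrightarrow> \<tau> i (\<rho> i a) = \<tau> i a" and "a \<in> C \<Longrightarrow> \<tau> i (\<rho> i a) = \<rho> i a"
proof -
  note T = comm_familiesD[OF \<tau>] and R = comm_familiesD[OF \<rho>]
  have inB: "\<tau> i a \<in> B \<longleftrightarrow> a \<in> B" and inC: "\<rho> i a \<in> C \<longleftrightarrow> a \<in> C" for i a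
    using permutes_in_image[OF T(1)] permutes_in_image[OF R(1)] by auto
  have idB: "a \<notin> B \<Longrightarrow> \<tau> i a = a" and idC: "a \<notin> C \<Longrightarrow> \<rho> i a = a" for i a
    using permutes_not_in[OF T(1)] permutes_not_in[OF R(1)] by auto
  show B: "a \<in> B \<Longrightarrow> \<tau> i (\<rho> i a) = \<tau> i a" and C: "a \<in> C \<Longrightarrow> \<tau> i (\<rho> i a) = \<rho> i a" for a i
    using disj inC[of i a] idB[of "\<rho> i a" i] idC[of a i] by (auto simp: disjoint_iff)
  have [simp]: "a \<in> C \<Longrightarrow> \<rho> i a \<in> C" "a \<in> B \<Longrightarrow> \<tau> i a \<in> B" for i a using inB inC by auto
  have perm: "\<tau> i \<circ> \<rho> i permutes V" for i
    using T(1)[of i] R(1)[of i] unfolding V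
    by (intro permutes_compose) (auto intro: permutes_subset)
  have comm: "\<tau> i (\<rho> i (\<tau> j (\<rho> j a))) = \<tau> j (\<rho> j (\<tau> i (\<rho> i a)))" for i j a
  proof -
    consider "a \<in> B" | "a \<in> C" | "a \<notin> B" "a \<notin> C" by blast
    thus ?thesis
    proof cases
      case 1 thus ?thesis using T(3)[of i j a] by (simp add: B)
    next
      case 2 thus ?thesis using R(3)[of i j a] by (metis C \<open>\<And>i a. a \<in> C \<Longrightarrow> \<rho> i a \<in> C\<close>)
    next
      case 3 thus ?thesis by (simp add: idB idC)
    qed
  qed
  show "(\<lambda>i. \<tau> i \<circ> \<rho> i) \<in> comm_families I V"
    using perm comm T(2) R(2) by (auto simp: comm_families_def)
qed

definition num_orbits :: "('i \<Rightarrow> 'a \<Rightarrow> 'a) \<Rightarrow> 'a set \<Rightarrow> nat" where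
  "num_orbits \<sigma> V = card (orb \<sigma> ` V)"

definition orbit_weight :: "real \<Rightarrow> 'i set \<Rightarrow> 'a set \<Rightarrow> real" where
  "orbit_weight x I V = (\<Sum>\<sigma>\<in>comm_families I V. x ^ num_orbits \<sigma> V)"

text \<open>Each \<open>\<sigma> i\<close> preserves the finite orbit \<open>B\<close> in both
  directions, so it also permutes the complement and the family splits. Conversely any two pieces
  can be glued, and by \<open>orb_cong\<close> the orbit of \<open>v\<close> is still
  \<open>B\<close> afterwards.\<close>

lemma bij_split_orbit:
  fixes V :: "'a set" and I :: "'i set"
  assumes V: "finite V" "B \<subseteq> V" and v: "v \<in> B"
  shows "bij_betw (\<lambda>\<sigma>. (\<lambda>i. restrict_id (\<sigma> i) B, \<lambda>i. restrict_id (\<sigma> i) (V - B)))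
           {\<sigma> \<in> comm_families I V. orb \<sigma> v = B} (trans_families I B v \<times> comm_families I (V - B))"
proof (rule bij_betw_byWitness[where f' = "\<lambda>(\<tau>, \<rho>) i. \<tau> i \<circ> \<rho> i"], goal_cases)
  case 1
  show ?case
  proof clarify
    fix \<sigma> assume \<sigma>: "\<sigma> \<in> comm_families I V" and "B = orb \<sigma> v"
    hence in_B: "\<sigma> i a \<in> B \<longleftrightarrow> a \<in> B" for i a
      using permutes_invariant_iff[of "\<sigma> i" V "orb \<sigma> v" a] comm_familiesD(1)[OF \<sigma>] V
      by (auto intro: orb.intros finite_subset)
    show "(\<lambda>i. restrict_id (\<sigma> i) (orb \<sigma> v) \<circ> restrict_id (\<sigma> i) (V - orb \<sigma> v)) = \<sigma>"
      using in_B comm_familiesD(1)[OF \<sigma>, THEN permutes_not_in] \<open>B = orb \<sigma> v\<close>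
      by (auto simp: fun_eq_iff restrict_id_def)
  qed
next
  case 2
  show ?case
  proof clarify
    fix \<tau> \<rho> :: "'i \<Rightarrow> 'a \<Rightarrow> 'a"
    assume \<tau>: "\<tau> \<in> trans_families I B v" and \<rho>: "\<rho> \<in> comm_families I (V - B)"
    have *: "B \<inter> (V - B) = {}" "V = B \<union> (V - B)" using V by auto
    note \<tau>' = \<tau>[unfolded trans_families_def, THEN CollectD, THEN conjunct1]
    note g = comm_families_glue(2,3)[OF \<tau>' \<rho> *]
    have "restrict_id (\<tau> i \<circ> \<rho> i) B a = \<tau> i a" "restrict_id (\<tau> i \<circ> \<rho> i) (V - B) a = \<rho> i a" for i a
      using g comm_familiesD(1)[OF \<tau>', THEN permutes_not_in]
        comm_familiesD(1)[OF \<rho>, THEN permutes_not_in]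
      by (auto simp: restrict_id_def)
    thus "(\<lambda>i. restrict_id ((\<tau> i \<circ> \<rho> i)) B) = \<tau> \<and> (\<lambda>i. restrict_id ((\<tau> i \<circ> \<rho> i)) (V - B)) = \<rho>"
      by (auto simp: fun_eq_iff)
  qed
next
  case 3
  show ?case
  proof clarify
    fix \<sigma> assume \<sigma>: "\<sigma> \<in> comm_families I V" and B: "B = orb \<sigma> v"
    hence in_B: "\<sigma> i a \<in> B \<longleftrightarrow> a \<in> B" for i a
      using permutes_invariant_iff[of "\<sigma> i" V "orb \<sigma> v" a] comm_familiesD(1)[OF \<sigma>] V
      by (auto intro: orb.intros finite_subset)
    have "orb (\<lambda>i. restrict_id (\<sigma> i) B) v = B"
      unfolding B by (rule orb_cong) auto
    moreover have "(\<lambda>i. restrict_id (\<sigma> i) B) \<in> comm_families I B"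
      by (rule comm_families_restrict[OF \<sigma>]) (use in_B V finite_subset in auto)
    moreover have "(\<lambda>i. restrict_id (\<sigma> i) (V - B)) \<in> comm_families I (V - B)"
      by (rule comm_families_restrict[OF \<sigma>])
        (use in_B V comm_familiesD(1)[OF \<sigma>] in \<open>auto simp: permutes_in_image\<close>)
    ultimately show "(\<lambda>i. restrict_id (\<sigma> i) (orb \<sigma> v)) \<in> trans_families I (orb \<sigma> v) v \<and>
       (\<lambda>i. restrict_id (\<sigma> i) (V - orb \<sigma> v)) \<in> comm_families I (V - orb \<sigma> v)"
      using B by (simp add: trans_families_def)
  qed
next
  case 4
  show ?case
  proof clarify
    fix \<tau> \<rho> :: "'i \<Rightarrow> 'a \<Rightarrow> 'a"
    assume \<tau>: "\<tau> \<in> trans_families I B v" and \<rho>: "\<rho> \<in> comm_families I (V - B)"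
    have *: "B \<inter> (V - B) = {}" "V = B \<union> (V - B)" using V by auto
    have \<tau>': "\<tau> \<in> comm_families I B" and o: "orb \<tau> v = B" using \<tau> by (auto simp: trans_families_def)
    note g = comm_families_glue[OF \<tau>' \<rho> *]
    have "orb (\<lambda>i. \<tau> i \<circ> \<rho> i) v = orb \<tau> v" by (rule orb_cong) (use g o in auto)
    with g o show "(\<lambda>i. \<tau> i \<circ> \<rho> i) \<in> comm_families I V \<and> orb (\<lambda>i. \<tau> i \<circ> \<rho> i) v = B" by simp
  qed
qed

text \<open>Orbits that avoid \<open>v\<close> are untouched by the restriction to the complement.
  The one orbit that is lost accounts for the single factor \<open>x\<close> in the
  recurrence.\<close>

lemma num_orbits_split:
  assumes \<sigma>: "\<sigma> \<in> comm_families I V" and V: "finite V" "v \<in> V"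
  shows "num_orbits \<sigma> V = Suc (num_orbits (\<lambda>i. restrict_id (\<sigma> i) (V - orb \<sigma> v)) (V - orb \<sigma> v))"
proof -
  let ?B = "orb \<sigma> v" and ?\<rho> = "\<lambda>i. restrict_id (\<sigma> i) (V - orb \<sigma> v)"
  have BV: "?B \<subseteq> V" by (rule orb_subset_carrier[OF comm_familiesD(1)[OF \<sigma>] V(2)])
  have in_B: "\<sigma> i a \<in> ?B \<longleftrightarrow> a \<in> ?B" for i a
    using permutes_invariant_iff[of "\<sigma> i" V "orb \<sigma> v" a] comm_familiesD(1)[OF \<sigma>] V BV
    by (auto intro: orb.intros finite_subset)
  have sub: "orb \<sigma> a \<subseteq> V - ?B" if "a \<in> V - ?B" for a
    by (rule orb_least) (use that in_B comm_familiesD(1)[OF \<sigma>] in \<open>auto simp: permutes_in_image\<close>)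
  have eq: "orb ?\<rho> a = orb \<sigma> a" if "a \<in> V - ?B" for a
    by (rule orb_cong) (use sub[OF that] in auto)
  have "orb \<sigma> ` V = insert ?B (orb \<sigma> ` (V - ?B))"
  proof -
    have "orb \<sigma> a = ?B" if "a \<in> ?B" for a
      by (rule orb_eq[OF comm_familiesD(1)[OF \<sigma>] V that])
    moreover have "V = ?B \<union> (V - ?B)" using BV by auto
    ultimately have "orb \<sigma> ` V = orb \<sigma> ` ?B \<union> orb \<sigma> ` (V - ?B)" by (metis image_Un)
    moreover have "orb \<sigma> ` ?B = {?B}"
      using \<open>\<And>a. a \<in> ?B \<Longrightarrow> orb \<sigma> a = ?B\<close> orb_base[of v \<sigma>] by blast
    ultimately show ?thesis by simp
  qed
  moreover have "?B \<notin> orb \<sigma> ` (V - ?B)"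
  proof
    assume "?B \<in> orb \<sigma> ` (V - ?B)"
    then obtain a where "a \<in> V - ?B" "?B = orb \<sigma> a" by blast
    thus False using orb_base[of a \<sigma>] by blast
  qed
  moreover have "orb \<sigma> ` (V - ?B) = orb ?\<rho> ` (V - ?B)" using eq by auto
  ultimately show ?thesis using V by (simp add: num_orbits_def)
qed

lemma orbit_weight_rec:
  fixes V :: "'a set" and I :: "'i set"
  assumes "finite I" "finite V" "v \<in> V"
  shows "orbit_weight x I V =
     (\<Sum>B | B \<subseteq> V \<and> v \<in> B. x * real (card (trans_families I B v)) * orbit_weight x I (V - B))"
proof -
  let ?F = "\<lambda>B. {\<sigma> \<in> comm_families I V. orb \<sigma> v = B}"
  have fin: "finite (comm_families I V)" by (rule finite_comm_families) fact+
  have finB: "finite {B. B \<subseteq> V \<and> v \<in> B}" using assms by (auto intro: finite_subset[of _ "Pow V"])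
  have "orbit_weight x I V = (\<Sum>B | B \<subseteq> V \<and> v \<in> B. \<Sum>\<sigma>\<in>?F B. x ^ num_orbits \<sigma> V)"
    unfolding orbit_weight_def
    by (rule sum.group[symmetric, OF fin finB])
      (use orb_subset_carrier[OF comm_familiesD(1) assms(3)] orb_base in fast)
  also have "\<dots> = (\<Sum>B | B \<subseteq> V \<and> v \<in> B. x * real (card (trans_families I B v)) * orbit_weight x I (V - B))"
  proof (rule sum.cong[OF refl], clarify)
    fix B assume B: "B \<subseteq> V" "v \<in> B"
    have "(\<Sum>\<sigma>\<in>?F B. x ^ num_orbits \<sigma> V) =
          (\<Sum>\<sigma>\<in>?F B. (\<lambda>(\<tau>, \<rho>). x * x ^ num_orbits \<rho> (V - B))
             (\<lambda>i. restrict_id (\<sigma> i) B, \<lambda>i. restrict_id (\<sigma> i) (V - B)))"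
      by (rule sum.cong[OF refl]) (auto simp: num_orbits_split[OF _ assms(2,3)])
    also have "\<dots> = (\<Sum>(\<tau>, \<rho>)\<in>trans_families I B v \<times> comm_families I (V - B). x * x ^ num_orbits \<rho> (V - B))"
      by (rule sum.reindex_bij_betw[OF bij_split_orbit]) (use assms B in auto)
    also have "\<dots> = x * real (card (trans_families I B v)) * orbit_weight x I (V - B)"
      by (simp add: sum.cartesian_product[symmetric] orbit_weight_def sum_distrib_left mult_ac)
    finally show "(\<Sum>\<sigma>\<in>?F B. x ^ num_orbits \<sigma> V) = x * real (card (trans_families I B v)) * orbit_weight x I (V - B)" .
  qed
  finally show ?thesis .
qed

subsection \<open>Counting transitive commuting families\<close>

text \<open>The image \<open>y\<close> of the added point is chosen first, and the rest is injected
  into \<open>T - {y}\<close>. The factorial stands on the left so that no division occurs; in this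
  form it cancels in \<open>card_tower_families\<close>.\<close>

lemma card_inj_funcset:
  assumes "finite S" "finite T" "card S \<le> card T"
  shows "fact (card T - card S) * card {f \<in> S \<rightarrow>\<^sub>E T. inj_on f S} = fact (card T)"
  using assms
proof (induction S arbitrary: T rule: finite_induct)
  case empty
  thus ?case by (simp add: PiE_empty_domain)
next
  case (insert x S)
  let ?J = "\<lambda>T. {g \<in> S \<rightarrow>\<^sub>E T. inj_on g S}"
  have eq: "{(y, g). y \<in> T \<and> g \<in> S \<rightarrow>\<^sub>E (T - {y}) \<and> inj_on g S} = Sigma T (\<lambda>y. ?J (T - {y}))"
    by auto
  have fin: "finite (?J (T - {y}))" for y
    using insert by (intro finite_subset[OF _ finite_PiE[of S "\<lambda>_. T - {y}"]]) auto
  have "card {f \<in> insert x S \<rightarrow>\<^sub>E T. inj_on f (insert x S)} = card (Sigma T (\<lambda>y. ?J (T - {y})))"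
    unfolding extensional_funcset_extend_domain_inj_on_eq[OF \<open>x \<notin> S\<close>]
    using card_image[OF extensional_funcset_extend_domain_inj_onI[OF \<open>x \<notin> S\<close>, of T]] by (simp add: eq)
  also have "\<dots> = (\<Sum>y\<in>T. card (?J (T - {y})))"
    using fin insert by (intro card_SigmaI) auto
  finally have "fact (card T - card (insert x S)) * card {f \<in> insert x S \<rightarrow>\<^sub>E T. inj_on f (insert x S)} =
      (\<Sum>y\<in>T. fact (card (T - {y}) - card S) * card (?J (T - {y})))"
    using insert by (simp add: sum_distrib_left)
  also have "\<dots> = (\<Sum>y\<in>T. fact (card T - 1))"
    using insert by (intro sum.cong refl) (subst insert.IH, auto)
  also have "\<dots> = fact (card T)"
    using insert by (cases "card T") auto
  finally show ?case .
qed

text \<open>An element of the centralizer of a transitive family is determined by the image of one point,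
  and since the family commutes, that image is arbitrary.\<close>

lemma bij_betw_centralizer:
  assumes \<tau>: "\<tau> \<in> trans_families I B v" and B: "finite B" "v \<in> B"
  shows "bij_betw (\<lambda>p. p v) {p. p permutes B \<and> (\<forall>i a. \<tau> i (p a) = p (\<tau> i a))} B"
    (is "bij_betw _ ?C B")
proof (rule bij_betw_imageI)
  have c: "\<tau> \<in> comm_families I B" and o: "orb \<tau> v = B" using \<tau> by (auto simp: trans_families_def)
  note T = comm_familiesD[OF c]
  show "inj_on (\<lambda>p. p v) ?C"
  proof (rule inj_onI)
    fix p q assume p: "p \<in> ?C" and q: "q \<in> ?C" and eq: "p v = q v"
    have "p a = q a" if "a \<in> orb \<tau> v" for a
      using that by induction (use p q eq in \<open>auto, metis\<close>)
    thus "p = q" using p q o by (auto simp: fun_eq_iff) (metis permutes_not_in)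
  qed
  have "z \<in> (\<lambda>p. p v) ` ?C" if "z \<in> orb \<tau> v" for z
    using that
  proof induction
    case orb_base
    show ?case by (rule image_eqI[of _ _ id]) (auto simp: permutes_id)
  next
    case (orb_step a i)
    then obtain p where p: "p \<in> ?C" "a = p v" by blast
    have "\<tau> i \<circ> p \<in> ?C" using p T(1)[of i] T(3) by (auto intro: permutes_compose)
    thus ?case using p(2) by (intro image_eqI[of _ _ "\<tau> i \<circ> p"]) auto
  qed
  thus "(\<lambda>p. p v) ` ?C = B"
    using o B(2) by (auto simp: permutes_in_image)
qed

section \<open>Blocks permuted by one additional permutation\<close>

text \<open>Here \<open>j\<close> is the added index. Switching \<open>\<sigma> j\<close> off splits
  \<open>V\<close> into orbits of the remaining family, and \<open>B\<close> is the block through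
  \<open>v\<close>. Since \<open>\<sigma> j\<close> commutes with that family, it maps blocks onto
  blocks.\<close>

definition tower_families :: "'i set \<Rightarrow> 'i \<Rightarrow> 'a set \<Rightarrow> 'a set \<Rightarrow> 'a \<Rightarrow> ('i \<Rightarrow> 'a \<Rightarrow> 'a) set" where
  "tower_families I j V B v = {\<sigma> \<in> trans_families (insert j I) V v. orb (\<sigma>(j := id)) v = B}"

text \<open>With a single block the remaining family is already transitive, so
  \<open>\<sigma> j\<close> ranges over its whole centralizer, which has \<open>card B\<close>
  elements by \<open>bij_betw_centralizer\<close>. This is the twist with which the cycle of blocks
  closes.\<close>

lemma tower_families_base:
  fixes B :: "'a set" and I :: "'i set"
  assumes "finite I" "finite B" "v \<in> B" "j \<notin> I"
  shows "card (tower_families I j B B v) = card (trans_families I B v) * card B"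
proof -
  let ?C = "\<lambda>\<tau>. {p. p permutes B \<and> (\<forall>i a. \<tau> i (p a) = p (\<tau> i a))}"
  have "bij_betw (\<lambda>\<sigma>. (\<sigma>(j := id), \<sigma> j)) (tower_families I j B B v) (Sigma (trans_families I B v) ?C)"
  proof (rule bij_betw_byWitness[where f' = "\<lambda>(\<tau>, p). \<tau>(j := p)"], goal_cases)
    case 1 show ?case by auto
  next
    case 2 show ?case using assms by (auto simp: trans_families_def comm_families_def)
  next
    case 3 show ?case
      by (auto simp: trans_families_def comm_families_def tower_families_def)
  next
    case 4 show ?case
    proof clarify
      fix \<tau> :: "'i \<Rightarrow> 'a \<Rightarrow> 'a" and p
      assume \<tau>: "\<tau> \<in> trans_families I B v" and p: "p permutes B" "\<forall>i a. \<tau> i (p a) = p (\<tau> i a)"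
      have c: "\<tau> \<in> comm_families I B" and o: "orb \<tau> v = B" using \<tau> by (auto simp: trans_families_def)
      note T = comm_familiesD[OF c]
      have tj: "\<tau>(j := id) = \<tau>" using T(2)[of j] assms by auto
      have c': "\<tau>(j := p) \<in> comm_families (insert j I) B"
        using T p by (auto simp: comm_families_def)
      have "orb \<tau> v \<subseteq> orb (\<tau>(j := p)) v"
      proof (rule orb_least)
        fix i a assume a: "a \<in> orb (\<tau>(j := p)) v"
        show "\<tau> i a \<in> orb (\<tau>(j := p)) v"
          using a orb_step[OF a, of i] T(2)[of j] assms(4) by (cases "i = j") auto
      qed (rule orb_base)
      hence "orb (\<tau>(j := p)) v = B"
        using o orb_subset_carrier[of "\<tau>(j := p)" B v] comm_familiesD(1)[OF c'] assms(3) by blast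
      thus "\<tau>(j := p) \<in> tower_families I j B B v"
        using c' tj o by (auto simp: tower_families_def trans_families_def)
    qed
  qed
  hence "card (tower_families I j B B v) = card (Sigma (trans_families I B v) ?C)"
    by (rule bij_betw_same_card)
  also have "\<dots> = (\<Sum>\<tau>\<in>trans_families I B v. card (?C \<tau>))"
  proof (rule card_SigmaI)
    show "finite (trans_families I B v)"
      using finite_comm_families[OF assms(1,2)] by (auto simp: trans_families_def)
    show "\<forall>\<tau>\<in>trans_families I B v. finite (?C \<tau>)"
      using finite_permutations[OF assms(2)] by auto
  qed
  also have "\<dots> = (\<Sum>\<tau>\<in>trans_families I B v. card B)"
    using bij_betw_same_card[OF bij_betw_centralizer] assms by (intro sum.cong) auto
  finally show ?thesis by simp
qed

text \<open>For the second claim: if \<open>\<sigma> j\<close> sent one point of \<open>B\<close>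
  into \<open>B\<close>, it would map all of \<open>B\<close> onto \<open>B\<close>, because it maps
  orbits of the other indices onto such orbits. Then \<open>B\<close> would be closed under the
  whole family, and transitivity would give \<open>V = B\<close>.\<close>

lemma tower_familiesD:
  fixes \<sigma> :: "'i \<Rightarrow> 'a \<Rightarrow> 'a"
  assumes \<sigma>: "\<sigma> \<in> tower_families I j V B v" and V: "finite V" "v \<in> V"
  shows "i \<noteq> j \<Longrightarrow> \<sigma> i a \<in> B \<longleftrightarrow> a \<in> B" and "V \<noteq> B \<Longrightarrow> a \<in> B \<Longrightarrow> \<sigma> j a \<notin> B"
    and "B \<subseteq> V" and "v \<in> B" and "finite B"
proof -
  let ?\<tau> = "\<sigma>(j := id)"
  have c: "\<sigma> \<in> comm_families (insert j I) V" and o: "orb \<sigma> v = V" and oB: "orb ?\<tau> v = B"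
    using \<sigma> by (auto simp: tower_families_def trans_families_def)
  note T = comm_familiesD[OF c]
  have perm: "?\<tau> i permutes V" for i using T(1)[of i] by (auto simp: permutes_id)
  show BV: "B \<subseteq> V" using orb_subset_carrier[of ?\<tau> V v] perm V(2) oB by metis
  show vB: "v \<in> B" using oB orb_base[of v ?\<tau>] by simp
  show fB: "finite B" using BV V(1) finite_subset by blast
  have step: "?\<tau> i a \<in> B" if "a \<in> B" for i a using that oB orb_step[of a ?\<tau> v i] by simp
  have inB: "\<sigma> i a \<in> B \<longleftrightarrow> a \<in> B" if "i \<noteq> j" for i a
    using permutes_invariant_iff[OF perm[of i] fB, of a] step[of _ i] that by auto
  thus "i \<noteq> j \<Longrightarrow> \<sigma> i a \<in> B \<longleftrightarrow> a \<in> B" .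
  assume "V \<noteq> B" and a: "a \<in> B"
  show "\<sigma> j a \<notin> B"
  proof
    assume *: "\<sigma> j a \<in> B"
    have "\<sigma> j ` orb ?\<tau> a = orb ?\<tau> (\<sigma> j a)"
      by (rule orb_image) (use T(3) in auto)
    moreover have "orb ?\<tau> a = B" "orb ?\<tau> (\<sigma> j a) = B"
      using orb_eq[of ?\<tau> V v] perm V oB a * by auto
    ultimately have "\<sigma> j ` B = B" by simp
    hence "orb \<sigma> v \<subseteq> B"
    proof (intro orb_least)
      show "\<sigma> i a \<in> B" if "a \<in> B" for i a
        using that inB[of i a] \<open>\<sigma> j ` B = B\<close> by (cases "i = j") auto
    qed (rule vB)
    thus False using o BV \<open>V \<noteq> B\<close> by simp
  qed
qed

text \<open>If \<open>B\<close> is an orbit of the \<open>I\<close>-part, then \<open>\<sigma> j\<close> moves \<open>B\<close> onto a disjoint block via \<open>g\<close>. Removing this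
  block and letting \<open>\<sigma> j\<close> jump over it leaves a family of the same kind on \<open>V - g ` B\<close>; given \<open>g\<close>, this
  is reversible.\<close>

locale block_swap =
  fixes I :: "'i set" and j :: 'i and V B :: "'a set" and v :: 'a and g :: "'a \<Rightarrow> 'a"
  assumes finV: "finite V" and BV: "B \<subseteq> V" and vB: "v \<in> B" and j: "j \<notin> I"
    and g: "g \<in> B \<rightarrow>\<^sub>E V - B" "inj_on g B"
begin

definition w :: "'a \<Rightarrow> 'a" where
  "w a = (if a \<in> B then g a else if a \<in> g ` B then inv_into B g a else a)"

definition peel :: "('i \<Rightarrow> 'a \<Rightarrow> 'a) \<Rightarrow> 'i \<Rightarrow> 'a \<Rightarrow> 'a" where
  "peel \<sigma> i = (if i = j then \<sigma> j \<circ> w else restrict_id (\<sigma> i) (V - g ` B))"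

text \<open>The other indices have no freedom on the restored block: index \<open>j\<close> acts on
  \<open>B\<close> as \<open>g\<close>, and commuting with it forces conjugation by
  \<open>w\<close>.\<close>

definition unpeel :: "('i \<Rightarrow> 'a \<Rightarrow> 'a) \<Rightarrow> 'i \<Rightarrow> 'a \<Rightarrow> 'a" where
  "unpeel \<rho> i = (if i = j then \<rho> j \<circ> w else (\<lambda>a. if a \<in> g ` B then w (\<rho> i (w a)) else \<rho> i a))"

lemma gB: "a \<in> B \<Longrightarrow> g a \<notin> B" "a \<in> B \<Longrightarrow> g a \<in> V" "a \<in> g ` B \<Longrightarrow> a \<notin> B" "a \<in> g ` B \<Longrightarrow> a \<in> V"
  using g(1) by auto

lemma w_simps:
  shows "a \<in> B \<Longrightarrow> w a = g a" "a \<in> B \<Longrightarrow> w (g a) = a" "a \<notin> B \<Longrightarrow> a \<notin> g ` B \<Longrightarrow> w a = a"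
    and w_w: "w (w a) = a" and w_in_B: "w a \<in> B \<longleftrightarrow> a \<in> g ` B" and w_in_gB: "w a \<in> g ` B \<longleftrightarrow> a \<in> B"
    and w_perm: "w permutes V"
proof -
  show 1: "a \<in> B \<Longrightarrow> w a = g a" "a \<in> B \<Longrightarrow> w (g a) = a" "a \<notin> B \<Longrightarrow> a \<notin> g ` B \<Longrightarrow> w a = a" for a
    using gB(1,3) by (auto simp: w_def inv_into_f_f[OF g(2)])
  show ww: "w (w a) = a" for a
  proof -
    consider "a \<in> B" | b where "b \<in> B" "a = g b" | "a \<notin> B" "a \<notin> g ` B" by blast
    thus ?thesis by cases (simp_all add: 1)
  qed
  show "w a \<in> B \<longleftrightarrow> a \<in> g ` B" "w a \<in> g ` B \<longleftrightarrow> a \<in> B"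
  proof -
    consider b where "b \<in> B" "a = b" | b where "b \<in> B" "a = g b" | "a \<notin> B" "a \<notin> g ` B" by blast
    hence "(w a \<in> B \<longleftrightarrow> a \<in> g ` B) \<and> (w a \<in> g ` B \<longleftrightarrow> a \<in> B)"
    proof cases
      case (1 b) thus ?thesis using \<open>\<And>a. a \<in> B \<Longrightarrow> w a = g a\<close>[of b] gB(1)[of b] gB(3)[of b] by auto
    next
      case (2 b) thus ?thesis using \<open>\<And>a. a \<in> B \<Longrightarrow> w (g a) = a\<close>[of b] gB(1)[of b] gB(3)[of b] by auto
    next
      case 3 thus ?thesis using \<open>\<And>a. a \<notin> B \<Longrightarrow> a \<notin> g ` B \<Longrightarrow> w a = a\<close>[of a] by auto
    qed
    thus "w a \<in> B \<longleftrightarrow> a \<in> g ` B" "w a \<in> g ` B \<longleftrightarrow> a \<in> B" by auto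
  qed
  have wV: "w a \<in> V" if "a \<in> V" for a
  proof -
    consider "a \<in> B" | b where "b \<in> B" "a = g b" | "a \<notin> B" "a \<notin> g ` B" by blast
    thus ?thesis using that BV gB(2) by cases (auto simp: 1)
  qed
  have "bij_betw w V V"
    by (rule bij_betw_byWitness[where f' = w]) (simp_all add: ww image_subset_iff wV)
  moreover have "w a = a" if "a \<notin> V" for a
    by (rule 1(3)) (use that BV gB(4) in blast)+
  ultimately show "w permutes V" by (rule bij_imp_permutes)
qed

text \<open>Commutation with \<open>\<sigma> j\<close>, which is \<open>g\<close> on
  \<open>B\<close>, transports the action of the other indices from \<open>B\<close> to its image;
  the last item is injectivity of \<open>\<sigma> j\<close>.\<close>

lemma block:
  assumes "\<sigma> \<in> tower_families I j V B v" "restrict (\<sigma> j) B = g"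
  shows "a \<in> B \<Longrightarrow> \<sigma> j a = g a" "a \<in> g ` B \<Longrightarrow> \<sigma> j (w a) = a"
    and "i \<noteq> j \<Longrightarrow> a \<in> B \<Longrightarrow> \<sigma> i (g a) = g (\<sigma> i a)"
    and "i \<noteq> j \<Longrightarrow> a \<in> g ` B \<Longrightarrow> \<sigma> i a = w (\<sigma> i (w a))"
    and "i \<noteq> j \<Longrightarrow> \<sigma> i a \<in> g ` B \<longleftrightarrow> a \<in> g ` B"
    and "\<sigma> j a \<in> g ` B \<longleftrightarrow> a \<in> B"
proof -
  have c: "\<sigma> \<in> comm_families (insert j I) V" using assms(1) by (auto simp: tower_families_def trans_families_def)
  note T = comm_familiesD[OF c]
  have inB: "i \<noteq> j \<Longrightarrow> \<sigma> i a \<in> B \<longleftrightarrow> a \<in> B" for i a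
    using tower_familiesD(1)[OF assms(1) finV] vB BV by auto
  show 1: "a \<in> B \<Longrightarrow> \<sigma> j a = g a" for a using assms(2) by auto
  show "a \<in> g ` B \<Longrightarrow> \<sigma> j (w a) = a" using 1 w_simps by auto
  show 2: "i \<noteq> j \<Longrightarrow> a \<in> B \<Longrightarrow> \<sigma> i (g a) = g (\<sigma> i a)" for i a
    using 1[of a] 1[of "\<sigma> i a"] T(3)[of i j a] inB[of i a] by simp
  show "i \<noteq> j \<Longrightarrow> a \<in> g ` B \<Longrightarrow> \<sigma> i a = w (\<sigma> i (w a))" using 2 w_simps(1,2) inB by auto
  have "finite (g ` B)" using BV finV finite_subset by blast
  thus "i \<noteq> j \<Longrightarrow> \<sigma> i a \<in> g ` B \<longleftrightarrow> a \<in> g ` B"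
    by (intro permutes_invariant_iff[OF T(1)]) (use 2 inB in auto)
  show "\<sigma> j a \<in> g ` B \<longleftrightarrow> a \<in> B"
  proof
    assume "\<sigma> j a \<in> g ` B"
    then obtain b where "b \<in> B" "\<sigma> j a = \<sigma> j b" using 1 by auto
    thus "a \<in> B" using permutes_inj[OF T(1)[of j]] by (auto dest: injD)
  qed (use 1 in auto)
qed

lemma peel_mem:
  assumes \<sigma>: "\<sigma> \<in> tower_families I j V B v" and sg: "restrict (\<sigma> j) B = g"
  shows "peel \<sigma> \<in> tower_families I j (V - g ` B) B v"
proof -
  have c: "\<sigma> \<in> comm_families (insert j I) V" and o: "orb \<sigma> v = V" and oB: "orb (\<sigma>(j := id)) v = B"
    using \<sigma> by (auto simp: tower_families_def trans_families_def)
  note T = comm_familiesD[OF c] and bl = block[OF \<sigma> sg]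
  have inV: "\<sigma> i a \<in> V \<longleftrightarrow> a \<in> V" for i a using T(1) by (rule permutes_in_image)
  have inB: "i \<noteq> j \<Longrightarrow> \<sigma> i a \<in> B \<longleftrightarrow> a \<in> B" for i a
    using tower_familiesD(1)[OF \<sigma> finV] vB BV by auto
  have pj: "peel \<sigma> j a = \<sigma> j (w a)" for a by (simp add: peel_def)
  have pi: "peel \<sigma> i a = (if a \<in> V - g ` B then \<sigma> i a else a)" if "i \<noteq> j" for i a
    using that by (simp add: peel_def restrict_id_def)
  have p_in: "peel \<sigma> i a \<in> V - g ` B" if "a \<in> V - g ` B" for i a
    using that inV bl(5,6) w_in_B permutes_in_image[OF w_perm] by (cases "i = j") (auto simp: pi pj)
  have p_id: "peel \<sigma> i a = a" if "a \<notin> V - g ` B" for i a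
  proof (cases "i = j")
    case True
    show ?thesis
    proof (cases "a \<in> g ` B")
      case True thus ?thesis using bl(2) \<open>i = j\<close> by (simp add: pj)
    next
      case False
      hence "a \<notin> V" using that by auto
      thus ?thesis using permutes_not_in[OF w_perm] permutes_not_in[OF T(1)] \<open>i = j\<close> by (simp add: pj)
    qed
  qed (use that in \<open>auto simp: pi\<close>)
  have perm: "peel \<sigma> i permutes (V - g ` B)" for i
  proof (cases "i = j")
    case True
    have "\<sigma> j \<circ> w permutes V" by (intro permutes_compose w_perm T(1))
    moreover have "peel \<sigma> i = \<sigma> j \<circ> w" using True by (simp add: peel_def)
    ultimately have "inj_on (peel \<sigma> i) (V - g ` B)" by (metis permutes_inj_on)
    thus ?thesis using finV p_in p_id by (intro inj_imp_permutes) auto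
  next
    case False
    have "inj_on (peel \<sigma> i) (V - g ` B)"
      using False permutes_inj[OF T(1)[of i]] by (auto simp: inj_on_def pi)
    thus ?thesis using finV p_in p_id by (intro inj_imp_permutes) auto
  qed
  have commj: "peel \<sigma> i (peel \<sigma> j a) = peel \<sigma> j (peel \<sigma> i a)" if a: "a \<in> V - g ` B" and i: "i \<noteq> j" for i a
  proof (cases "a \<in> B")
    case True
    have "peel \<sigma> j a \<in> V - g ` B" by (rule p_in) fact
    thus ?thesis using a i True T(3) inB bl(1,3) gB by (simp add: pi pj w_simps) metis
  next
    case False
    have "peel \<sigma> j a \<in> V - g ` B" by (rule p_in) fact
    thus ?thesis using a i False T(3) inB bl(5) by (auto simp: pi pj w_simps)
  qed
  have comm: "peel \<sigma> i (peel \<sigma> i' a) = peel \<sigma> i' (peel \<sigma> i a)" for i i' a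
  proof (cases "a \<in> V - g ` B")
    case True
    consider "i = j" "i' = j" | "i = j" "i' \<noteq> j" | "i \<noteq> j" "i' = j" | "i \<noteq> j" "i' \<noteq> j" by blast
    thus ?thesis
    proof cases
      case 4
      have "peel \<sigma> i a \<in> V - g ` B" "peel \<sigma> i' a \<in> V - g ` B" using p_in True by blast+
      thus ?thesis using 4 True T(3) by (simp add: pi)
    qed (use commj True in auto)
  qed (simp add: p_id)
  have pid: "peel \<sigma> i = id" if "i \<notin> insert j I" for i
    using that T(2)[of i] by (auto simp: peel_def restrict_id_def fun_eq_iff)
  have c': "peel \<sigma> \<in> comm_families (insert j I) (V - g ` B)"
    using perm comm pid by (auto simp: comm_families_def)
  have vV: "v \<in> V - g ` B" using vB BV gB by auto
  have "orb ((peel \<sigma>)(j := id)) v = orb (\<sigma>(j := id)) v"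
  proof (rule orb_cong)
    fix i a assume "a \<in> orb (\<sigma>(j := id)) v"
    hence "a \<in> V - g ` B" using oB BV gB by auto
    thus "((peel \<sigma>)(j := id)) i a = (\<sigma>(j := id)) i a" by (auto simp: pi)
  qed
  hence oB': "orb ((peel \<sigma>)(j := id)) v = B" by (simp only: oB)
  \<comment> \<open>Transitivity of the peeled family: \<open>?r\<close> projects \<open>V\<close>
    onto what remains by sending the removed block back to \<open>B\<close>. Under it a step of
    \<open>\<sigma>\<close> becomes one step of \<open>peel \<sigma>\<close>, except that the step
    from \<open>B\<close> into the removed block becomes no step at all.\<close>
  let ?r = "\<lambda>a. if a \<in> g ` B then w a else a"
  have r: "?r a \<in> orb (peel \<sigma>) v \<and> a \<in> V" if "a \<in> orb \<sigma> v" for a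
    using that
  proof induction
    case orb_base
    show ?case using vV orb.orb_base[of v] by auto
  next
    case (orb_step a i)
    have aV: "a \<in> V" and ra: "?r a \<in> orb (peel \<sigma>) v" using orb_step.IH by auto
    have next_r: "peel \<sigma> k (?r a) \<in> orb (peel \<sigma>) v" for k by (rule orb.orb_step) (rule ra)
    have "?r (\<sigma> i a) \<in> orb (peel \<sigma>) v"
    proof (cases "i = j")
      case True
      consider "a \<in> B" | "a \<in> g ` B" | "a \<notin> B" "a \<notin> g ` B" by blast
      thus ?thesis
      proof cases
        case 1
        have "?r (\<sigma> i a) = ?r a" using 1 bl(1) True gB w_simps by auto
        thus ?thesis using ra by metis
      next
        case 2
        have "?r (\<sigma> i a) = peel \<sigma> j (?r a)" using 2 bl(6)[of a] True gB w_w by (auto simp: pj)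
        thus ?thesis using next_r by metis
      next
        case 3
        have "?r (\<sigma> i a) = peel \<sigma> j (?r a)" using 3 bl(6)[of a] True w_simps by (auto simp: pj)
        thus ?thesis using next_r by metis
      qed
    next
      case False
      have "?r (\<sigma> i a) = peel \<sigma> i (?r a)"
      proof (cases "a \<in> g ` B")
        case True
        hence "w a \<in> V - g ` B" using w_in_B[of a] gB BV by blast
        thus ?thesis using True False bl(4)[of i a] bl(5)[of i a] w_w by (auto simp: pi)
      next
        case a: False
        thus ?thesis using aV False bl(5)[of i a] by (auto simp: pi)
      qed
      thus ?thesis using next_r by metis
    qed
    thus ?case using aV inV by auto
  qed
  have "V - g ` B \<subseteq> orb (peel \<sigma>) v" using r o by force
  moreover have "orb (peel \<sigma>) v \<subseteq> V - g ` B" by (rule orb_subset_carrier[OF perm vV])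
  ultimately show ?thesis using c' oB' by (auto simp: tower_families_def trans_families_def)
qed

lemma unpeel_mem:
  assumes \<rho>: "\<rho> \<in> tower_families I j (V - g ` B) B v"
  shows "unpeel \<rho> \<in> tower_families I j V B v" "restrict (unpeel \<rho> j) B = g"
proof -
  have c: "\<rho> \<in> comm_families (insert j I) (V - g ` B)" and o: "orb \<rho> v = V - g ` B"
    and oB: "orb (\<rho>(j := id)) v = B"
    using \<rho> by (auto simp: tower_families_def trans_families_def)
  note T = comm_familiesD[OF c]
  have vV: "v \<in> V - g ` B" using vB BV gB by auto
  have inV: "\<rho> i a \<in> V - g ` B \<longleftrightarrow> a \<in> V - g ` B" for i a using T(1) by (rule permutes_in_image)
  have ngB: "a \<notin> g ` B \<Longrightarrow> \<rho> i a \<notin> g ` B" for i a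
    using inV[of i a] permutes_not_in[OF T(1)[of i], of a] by (cases "a \<in> V") auto
  have idn: "a \<notin> V - g ` B \<Longrightarrow> \<rho> i a = a" for i a by (rule permutes_not_in[OF T(1)])
  have inB: "i \<noteq> j \<Longrightarrow> \<rho> i a \<in> B \<longleftrightarrow> a \<in> B" for i a
    using tower_familiesD(1)[OF \<rho>] vV finV by auto
  have uj: "unpeel \<rho> j a = \<rho> j (w a)" for a by (simp add: unpeel_def)
  have ui: "unpeel \<rho> i a = (if a \<in> g ` B then w (\<rho> i (w a)) else \<rho> i a)" if "i \<noteq> j" for i a
    using that by (simp add: unpeel_def)
  \<comment> \<open>For \<open>a\<close> in \<open>B\<close> the point \<open>w a\<close> lies
    outside the carrier of \<open>\<rho>\<close>, so \<open>\<rho> j\<close> fixes it.\<close>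
  have uB: "unpeel \<rho> j a = g a" if "a \<in> B" for a using that by (simp add: uj w_simps idn)
  show "restrict (unpeel \<rho> j) B = g"
  proof
    fix a show "restrict (unpeel \<rho> j) B a = g a"
      using PiE_arb[OF g(1), of a] uB[of a] by (cases "a \<in> B") simp_all
  qed
  have u_in_gB: "unpeel \<rho> i a \<in> g ` B" if "i \<noteq> j" "a \<in> g ` B" for i a
    using that inB[of i "w a"] w_in_B[of a] w_in_gB[of "\<rho> i (w a)"] by (simp add: ui)
  have u_in: "unpeel \<rho> i a \<in> V" if "a \<in> V" for i a
  proof (cases "i = j")
    case True
    have "w a \<in> V" using permutes_in_image[OF w_perm, of a] that by blast
    thus ?thesis using inV[of j "w a"] idn[of "w a" j] True
      by (cases "w a \<in> g ` B") (simp_all add: uj)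
  next
    case False
    show ?thesis
    proof (cases "a \<in> g ` B")
      case True
      thus ?thesis using u_in_gB[OF False True] gB by blast
    next
      case a: False
      thus ?thesis using that inV[of i a] False by (simp add: ui)
    qed
  qed
  have u_id: "unpeel \<rho> i a = a" if "a \<notin> V" for i a
    using that permutes_not_in[OF w_perm that] idn[of a i] gB(4)[of a] by (cases "i = j") (auto simp: ui uj)
  have inj: "inj (unpeel \<rho> i)" for i
  proof (cases "i = j")
    case True
    have "inj (\<rho> j \<circ> w)" using permutes_inj[OF w_perm] permutes_inj[OF T(1)] by (rule inj_compose[rotated])
    thus ?thesis using True by (simp add: unpeel_def)
  next
    case False
    have inj: "\<rho> i a = \<rho> i b \<longleftrightarrow> a = b" "w a = w b \<longleftrightarrow> a = b" for a b
      using permutes_inj[OF w_perm] permutes_inj[OF T(1)[of i]] by (simp_all add: inj_eq)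
    show ?thesis
    proof (rule injI)
      fix a b assume eq: "unpeel \<rho> i a = unpeel \<rho> i b"
      show "a = b"
      proof (cases "a \<in> g ` B \<longleftrightarrow> b \<in> g ` B")
        case True
        thus ?thesis using eq by (cases "a \<in> g ` B") (simp_all add: ui[OF False] inj)
      next
        case ne: False
        have "unpeel \<rho> i a \<in> g ` B \<longleftrightarrow> a \<in> g ` B" for a
          using u_in_gB[OF False, of a] ngB[of a i] by (cases "a \<in> g ` B") (simp_all add: ui[OF False])
        from this[of a] this[of b] show ?thesis using ne eq by simp
      qed
    qed
  qed
  have perm: "unpeel \<rho> i permutes V" for i
    using inj_on_subset[OF inj[of i] subset_UNIV] finV u_in u_id by (intro inj_imp_permutes) auto
  have commj: "unpeel \<rho> i (unpeel \<rho> j a) = unpeel \<rho> j (unpeel \<rho> i a)" if i: "i \<noteq> j" for i a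
  proof -
    consider "a \<in> B" | "a \<in> g ` B" | "a \<notin> B" "a \<notin> g ` B" by blast
    thus ?thesis
    proof cases
      case 1
      hence "\<rho> i a \<in> B" using inB[OF i] by simp
      moreover have "a \<notin> g ` B" "g a \<in> g ` B" using 1 gB(3)[of a] by auto
      ultimately show ?thesis using 1 by (simp add: uB ui[OF i] w_simps(1,2))
    next
      case 2
      have "w a \<in> B" using 2 w_in_B[of a] by simp
      hence "\<rho> j (w a) \<notin> g ` B" using gB(3)[of "w a"] ngB[of "w a" j] by blast
      thus ?thesis using 2 T(3)[of i j "w a"] by (simp add: ui[OF i] uj w_w)
    next
      case 3
      have "\<rho> j a \<notin> g ` B" "\<rho> i a \<notin> g ` B" "\<rho> i a \<notin> B" using 3 ngB[of a] inB[OF i, of a] by auto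
      thus ?thesis using 3 T(3)[of i j a] by (simp add: ui[OF i] uj w_simps(3))
    qed
  qed
  have comm: "unpeel \<rho> i (unpeel \<rho> i' a) = unpeel \<rho> i' (unpeel \<rho> i a)" for i i' a
  proof -
    consider "i = j" "i' = j" | "i = j" "i' \<noteq> j" | "i \<noteq> j" "i' = j" | "i \<noteq> j" "i' \<noteq> j" by blast
    thus ?thesis
    proof cases
      case 4
      show ?thesis
      proof (cases "a \<in> g ` B")
        case True
        have *: "unpeel \<rho> k (unpeel \<rho> k' a) = w (\<rho> k (\<rho> k' (w a)))" if "k \<noteq> j" "k' \<noteq> j" for k k'
          using u_in_gB[OF that(2) True] True by (simp add: ui[OF that(1)]) (simp add: ui[OF that(2)] w_w)
        show ?thesis using *[OF 4] *[OF 4(2,1)] T(3)[of i i' "w a"] by simp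
      next
        case False
        thus ?thesis using 4 T(3)[of i i' a] ngB[OF False, of i] ngB[OF False, of i'] by (simp add: ui)
      qed
    qed (use commj in auto)
  qed
  have uid: "unpeel \<rho> i = id" if "i \<notin> insert j I" for i
    using that T(2)[of i] by (auto simp: unpeel_def fun_eq_iff w_w)
  have c': "unpeel \<rho> \<in> comm_families (insert j I) V"
    using perm comm uid by (auto simp: comm_families_def)
  have "orb ((unpeel \<rho>)(j := id)) v = orb (\<rho>(j := id)) v"
  proof (rule orb_cong)
    fix i a assume "a \<in> orb (\<rho>(j := id)) v"
    hence "a \<notin> g ` B" using oB gB by auto
    thus "((unpeel \<rho>)(j := id)) i a = (\<rho>(j := id)) i a" by (auto simp: ui)
  qed
  hence oB': "orb ((unpeel \<rho>)(j := id)) v = B" by (simp only: oB)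
  let ?O = "orb (unpeel \<rho>) v"
  have 1: "a \<in> ?O \<and> a \<notin> g ` B" if "a \<in> orb \<rho> v" for a
    using that
  proof induction
    case orb_base show ?case using vV by (auto intro: orb.orb_base)
  next
    case (orb_step a i)
    hence a: "a \<in> ?O" "a \<notin> g ` B" by auto
    have "\<rho> i a \<in> ?O"
    proof (cases "i = j")
      case False
      thus ?thesis using orb.orb_step[OF a(1), of i] a by (simp add: ui)
    next
      case True
      show ?thesis
      proof (cases "a \<in> B")
        case B: True
        \<comment> \<open>From \<open>B\<close>, one step of \<open>\<rho> j\<close> costs two steps
          of the unpeeled family: into the restored block and out of it.\<close>
        have "unpeel \<rho> j (unpeel \<rho> j a) = \<rho> j a" using B by (simp add: uB) (simp add: uj w_simps)
        thus ?thesis using orb.orb_step[OF orb.orb_step[OF a(1), of j], of j] True by simp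
      next
        case False
        thus ?thesis using orb.orb_step[OF a(1), of j] True a by (simp add: uj w_simps)
      qed
    qed
    thus ?case using a ngB by blast
  qed
  have "g a \<in> ?O" if "a \<in> B" for a
  proof -
    have "a \<in> orb \<rho> v" using o that BV gB(1)[OF that] gB(3)[of a] by blast
    hence "a \<in> ?O" using 1 by simp
    thus ?thesis using orb.orb_step[of a "unpeel \<rho>" v j] uB that by simp
  qed
  moreover have "V - g ` B \<subseteq> ?O" using 1 o by auto
  ultimately have "V \<subseteq> ?O" by blast
  moreover have "?O \<subseteq> V" by (rule orb_subset_carrier[OF perm]) (use vB BV in auto)
  ultimately show "unpeel \<rho> \<in> tower_families I j V B v"
    using c' oB' by (auto simp: tower_families_def trans_families_def)
qed

lemma bij_peel:
  "bij_betw peel {\<sigma> \<in> tower_families I j V B v. restrict (\<sigma> j) B = g}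
     (tower_families I j (V - g ` B) B v)"
proof (rule bij_betw_byWitness[where f' = unpeel], goal_cases)
  case 1
  show ?case
  proof (intro ballI, elim CollectE conjE)
    fix \<sigma> assume \<sigma>: "\<sigma> \<in> tower_families I j V B v" and sg: "restrict (\<sigma> j) B = g"
    note bl = block[OF \<sigma> sg]
    have c: "\<sigma> \<in> comm_families (insert j I) V"
      using \<sigma> by (auto simp: tower_families_def trans_families_def)
    have "unpeel (peel \<sigma>) i a = \<sigma> i a" for i a
    proof (cases "i = j")
      case True
      thus ?thesis by (simp add: unpeel_def peel_def w_w)
    next
      case False
      consider "a \<in> g ` B" | "a \<notin> g ` B" "a \<in> V" | "a \<notin> V" by blast
      thus ?thesis
      proof cases
        case 1
        hence "w a \<in> V - g ` B" using w_in_B[of a] gB BV by blast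
        thus ?thesis using 1 bl(4)[OF False 1] False by (simp add: unpeel_def peel_def)
      qed (use False gB permutes_not_in[OF comm_familiesD(1)[OF c]] in
             \<open>auto simp: unpeel_def peel_def restrict_id_def\<close>)
    qed
    thus "unpeel (peel \<sigma>) = \<sigma>" by (simp add: fun_eq_iff)
  qed
next
  case 2
  show ?case
  proof
    fix \<rho> assume \<rho>: "\<rho> \<in> tower_families I j (V - g ` B) B v"
    have c: "\<rho> \<in> comm_families (insert j I) (V - g ` B)"
      using \<rho> by (auto simp: tower_families_def trans_families_def)
    have "peel (unpeel \<rho>) i a = \<rho> i a" for i a
      using permutes_not_in[OF comm_familiesD(1)[OF c], of a i]
      by (cases "i = j") (auto simp: unpeel_def peel_def w_w restrict_id_def)
    thus "peel (unpeel \<rho>) = \<rho>" by (simp add: fun_eq_iff)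
  qed
qed (use peel_mem unpeel_mem in blast)+

end

text \<open>Induction by peeling one block. Write b and m for the sizes of \<open>B\<close> and
  \<open>V\<close>. There are (m-b)!/(m-2b)! choices of \<open>g\<close>, and by the induction
  hypothesis each leaves a factor (m-2b)!, so the factorials telescope. Each peeling lowers m by b
  and the process must end at \<open>V = B\<close>, hence the divisibility condition.\<close>

lemma card_tower_families:
  fixes V B :: "'a set" and I :: "'i set"
  assumes "finite I" "finite V" "B \<subseteq> V" "v \<in> B" "j \<notin> I"
  shows "card (tower_families I j V B v) =
    (if card B dvd card V then card (trans_families I B v) * card B * fact (card V - card B) else 0)"
  using assms(2,3)
proof (induction "card V" arbitrary: V rule: less_induct)
  case less
  have fB: "finite B" using less finite_subset by blast
  have B0: "card B > 0" using fB assms(4) by (auto simp: card_gt_0_iff)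
  show ?case
  proof (cases "V = B")
    case True
    thus ?thesis using tower_families_base[OF assms(1) fB assms(4,5)] by simp
  next
    case False
    let ?J = "{g \<in> B \<rightarrow>\<^sub>E V - B. inj_on g B}"
    let ?T = "tower_families I j V B v"
    have finT: "finite ?T"
      using finite_comm_families[of "insert j I" V] less assms(1)
      by (auto simp: tower_families_def trans_families_def)
    have finJ: "finite ?J"
      using less fB by (intro finite_subset[OF _ finite_PiE[of B "\<lambda>_. V - B"]]) auto
    have vV: "v \<in> V" using assms(4) less by auto
    have "(\<lambda>\<sigma>. restrict (\<sigma> j) B) ` ?T \<subseteq> ?J"
    proof clarify
      fix \<sigma> assume \<sigma>: "\<sigma> \<in> ?T"
      hence p: "\<sigma> j permutes V"
        using comm_familiesD(1)[of \<sigma>] by (auto simp: tower_families_def trans_families_def)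
      have "\<sigma> j a \<in> V - B" if "a \<in> B" for a
        using tower_familiesD(2)[OF \<sigma> less(2) vV False that] that less permutes_in_image[OF p, of a] by auto
      thus "restrict (\<sigma> j) B \<in> B \<rightarrow>\<^sub>E V - B \<and> inj_on (restrict (\<sigma> j) B) B"
        using permutes_inj_on[OF p, of B] by (auto simp: inj_on_def)
    qed
    hence "card ?T = (\<Sum>g\<in>?J. card {\<sigma> \<in> ?T. restrict (\<sigma> j) B = g})"
      using sum.group[OF finT finJ, of "\<lambda>\<sigma>. restrict (\<sigma> j) B" "\<lambda>_. 1::nat"] by simp
    also have "\<dots> = (\<Sum>g\<in>?J. if card B dvd card V
        then card (trans_families I B v) * card B * fact (card (V - B) - card B) else 0)"
    proof (rule sum.cong[OF refl])
      fix g assume g: "g \<in> ?J"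
      hence gVB: "g ` B \<subseteq> V - B" and inj: "inj_on g B" by auto
      interpret block_swap I j V B v g
        by standard (use g less assms in auto)
      have sub: "g ` B \<subseteq> V" using gVB by auto
      have c: "card (V - g ` B) = card V - card B"
        using sub less(2) inj by (simp add: card_Diff_subset finite_subset card_image)
      have le: "card B \<le> card (V - B)" using card_inj_on_le[OF inj gVB] less by simp
      have le': "card B \<le> card V" using less card_mono by blast
      have "card {\<sigma> \<in> ?T. restrict (\<sigma> j) B = g} = card (tower_families I j (V - g ` B) B v)"
        by (rule bij_betw_same_card[OF bij_peel])
      also have "\<dots> = (if card B dvd card (V - g ` B)
          then card (trans_families I B v) * card B * fact (card (V - g ` B) - card B) else 0)"
        using gVB less B0 le' c by (intro less.hyps) auto
      also have "card B dvd card (V - g ` B) \<longleftrightarrow> card B dvd card V"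
        using le' unfolding c by (simp add: dvd_minus_self)
      finally show "card {\<sigma> \<in> ?T. restrict (\<sigma> j) B = g} = (if card B dvd card V
        then card (trans_families I B v) * card B * fact (card (V - B) - card B) else 0)"
        unfolding c card_Diff_subset[OF fB less(3)] .
    qed
    also have "\<dots> = (if card B dvd card V then card (trans_families I B v) * card B * fact (card V - card B) else 0)"
    proof (cases "card B dvd card V")
      case True
      then obtain q where q: "card V = card B * q" by blast
      have "B \<subset> V" using False less by auto
      hence "card B < card V" using less by (intro psubset_card_mono)
      \<comment> \<open>With at least two blocks' worth of points, \<open>B\<close> has room to be
        injected into \<open>V - B\<close>, as the cancellation in \<open>card_inj_funcset\<close>
        requires.\<close>
      hence "q \<ge> 2" using q B0 by (cases q; cases "q - 1") auto
      hence "2 * card B \<le> card V" using q by (simp add: mult.commute)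
      hence "card B \<le> card (V - B)" using fB less by (simp add: card_Diff_subset)
      from card_inj_funcset[OF fB _ this] less
      have "fact (card (V - B) - card B) * card ?J = fact (card (V - B))" by simp
      thus ?thesis using True fB less by (simp add: card_Diff_subset mult_ac)
    qed simp
    finally show ?thesis .
  qed
qed

lemma sum_pointed_subsets:
  fixes f :: "nat \<Rightarrow> 'b :: comm_semiring_1"
  assumes V: "finite V" "v \<in> V"
  shows "(\<Sum>B | B \<subseteq> V \<and> v \<in> B. f (card B)) =
     (\<Sum>k=1..card V. of_nat ((card V - 1) choose (k - 1)) * f k)"
proof -
  let ?S = "V - {v}"
  have cS: "card ?S = card V - 1" "card V > 0" using V by (auto simp: card_gt_0_iff)
  have bij: "bij_betw (insert v) (Pow ?S) {B. B \<subseteq> V \<and> v \<in> B}"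
    by (rule bij_betw_byWitness[where f' = "\<lambda>B. B - {v}"]) (use V(2) in auto)
  have "(\<Sum>B | B \<subseteq> V \<and> v \<in> B. f (card B)) = (\<Sum>C\<in>Pow ?S. f (card (insert v C)))"
    by (rule sum.reindex_bij_betw[OF bij, symmetric])
  also have "\<dots> = (\<Sum>C\<in>Pow ?S. f (Suc (card C)))"
  proof (rule sum.cong[OF refl])
    fix C assume "C \<in> Pow ?S"
    hence "finite C" "v \<notin> C" using V finite_subset by auto
    thus "f (card (insert v C)) = f (Suc (card C))" by simp
  qed
  also have "\<dots> = (\<Sum>k\<le>card ?S. \<Sum>C | C \<in> Pow ?S \<and> card C = k. f (Suc (card C)))"
    by (intro sum.group[symmetric]) (use V card_mono[of ?S] in \<open>auto simp del: card_Diff_singleton\<close>)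
  also have "\<dots> = (\<Sum>k\<le>card ?S. of_nat (card ?S choose k) * f (Suc k))"
  proof (rule sum.cong[OF refl])
    fix k
    have "(\<Sum>C | C \<in> Pow ?S \<and> card C = k. f (Suc (card C))) = (\<Sum>C | C \<subseteq> ?S \<and> card C = k. f (Suc k))"
      by (rule sum.cong) auto
    thus "(\<Sum>C | C \<in> Pow ?S \<and> card C = k. f (Suc (card C))) = of_nat (card ?S choose k) * f (Suc k)"
      using n_subsets[of ?S k] V by simp
  qed
  also have "\<dots> = (\<Sum>k=1..card V. of_nat ((card V - 1) choose (k - 1)) * f k)"
    using cS by (intro sum.reindex_bij_witness[of _ "\<lambda>k. k - 1" Suc]) auto
  finally show ?thesis .
qed

text \<open>The number of subgroups of index \<open>m\<close> in \<open>\<int>\<^sup>l\<close>. At \<open>m = 0\<close> the sum runs over an infinite set and is 0.\<close>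

primrec num_subgroups :: "nat \<Rightarrow> nat \<Rightarrow> nat" where
  "num_subgroups 0 m = (if m = 1 then 1 else 0)"
| "num_subgroups (Suc l) m = (\<Sum>k | k dvd m. k * num_subgroups l k)"

text \<open>Families are grouped by the block of \<open>v\<close> that remains when index
  \<open>j\<close> is switched off. With m = \<open>card V\<close>, a block size k dividing m
  contributes (m-1 choose k-1) (k-1)! s(k) k (m-k)! = (m-1)! k s(k), where s belongs to the smaller
  index set; this is a term of the divisor recursion.\<close>

lemma card_trans_families:
  fixes V :: "'a set" and I :: "'i set"
  assumes "finite I" "finite V" "v \<in> V"
  shows "card (trans_families I V v) = fact (card V - 1) * num_subgroups (card I) (card V)"
  using assms
proof (induction I arbitrary: V rule: finite_induct)
  case empty
  have "comm_families {} V = {\<lambda>_ :: 'i. id :: 'a \<Rightarrow> 'a}"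
    by (auto simp: comm_families_def permutes_id fun_eq_iff)
  moreover have "orb (\<lambda>_ :: 'i. id) v = {v}"
    using orb_least[of v "{v}" "\<lambda>_ :: 'i. id"] orb_base[of v "\<lambda>_ :: 'i. id"] by auto
  moreover have "V = {v} \<longleftrightarrow> card V = 1"
    using empty by (metis card_1_singletonE is_singletonI is_singleton_altdef singletonD)
  ultimately have "trans_families {} V v = (if card V = 1 then {\<lambda>_ :: 'i. id} else {})"
    by (auto simp: trans_families_def)
  thus ?case by simp
next
  case (insert j I)
  let ?T = "trans_families (insert j I) V v"
  have finT: "finite ?T"
    using finite_comm_families[of "insert j I" V] insert by (auto simp: trans_families_def)
  have finS: "finite {B. B \<subseteq> V \<and> v \<in> B}" using insert by (auto intro: finite_subset[of _ "Pow V"])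
  have "(\<lambda>\<sigma>. orb (\<sigma>(j := id)) v) ` ?T \<subseteq> {B. B \<subseteq> V \<and> v \<in> B}"
  proof clarify
    fix \<sigma> assume "\<sigma> \<in> ?T"
    hence c: "\<sigma> \<in> comm_families (insert j I) V" by (simp add: trans_families_def)
    have "(\<sigma>(j := id)) i permutes V" for i using comm_familiesD(1)[OF c, of i] by (auto simp: permutes_id)
    hence "orb (\<sigma>(j := id)) v \<subseteq> V" using insert by (intro orb_subset_carrier) auto
    thus "orb (\<sigma>(j := id)) v \<subseteq> V \<and> v \<in> orb (\<sigma>(j := id)) v" by (simp add: orb_base)
  qed
  hence "card ?T = (\<Sum>B | B \<subseteq> V \<and> v \<in> B. card (tower_families I j V B v))"
    using sum.group[OF finT finS, of "\<lambda>\<sigma>. orb (\<sigma>(j := id)) v" "\<lambda>_. 1::nat"]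
    by (simp add: tower_families_def)
  also have "\<dots> = (\<Sum>B | B \<subseteq> V \<and> v \<in> B. (\<lambda>k. if k dvd card V
      then fact (k - 1) * num_subgroups (card I) k * k * fact (card V - k) else 0) (card B))"
  proof (rule sum.cong[OF refl], clarify)
    fix B assume B: "B \<subseteq> V" "v \<in> B"
    thus "card (tower_families I j V B v) = (\<lambda>k. if k dvd card V
      then fact (k - 1) * num_subgroups (card I) k * k * fact (card V - k) else 0) (card B)"
      using insert.IH[of B] insert.hyps insert.prems finite_subset[OF B(1)] by (simp add: card_tower_families)
  qed
  also have "\<dots> = (\<Sum>k=1..card V. ((card V - 1) choose (k - 1)) * (if k dvd card V
      then fact (k - 1) * num_subgroups (card I) k * k * fact (card V - k) else 0))"
    using sum_pointed_subsets[OF insert.prems, of "\<lambda>k. if k dvd card V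
      then fact (k - 1) * num_subgroups (card I) k * k * fact (card V - k) else 0"] by simp
  also have "\<dots> = (\<Sum>k=1..card V. if k dvd card V then fact (card V - 1) * (k * num_subgroups (card I) k) else 0)"
  proof (rule sum.cong[OF refl])
    fix k assume k: "k \<in> {1..card V}"
    have "fact (k - 1) * fact (card V - 1 - (k - 1)) * ((card V - 1) choose (k - 1)) = fact (card V - 1)"
      using k by (intro binomial_fact_lemma) auto
    moreover have "card V - 1 - (k - 1) = card V - k" using k by auto
    ultimately show "((card V - 1) choose (k - 1)) * (if k dvd card V
      then fact (k - 1) * num_subgroups (card I) k * k * fact (card V - k) else 0) =
      (if k dvd card V then fact (card V - 1) * (k * num_subgroups (card I) k) else 0)"
      by (simp add: mult_ac)
  qed
  also have "\<dots> = (\<Sum>k | k dvd card V. fact (card V - 1) * (k * num_subgroups (card I) k))"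
  proof -
    have "card V > 0" using insert.prems by (auto simp: card_gt_0_iff)
    hence "k dvd card V \<longleftrightarrow> k \<in> {1..card V} \<and> k dvd card V" for k
      using dvd_imp_le[of k "card V"] dvd_pos_nat[of "card V" k] by auto
    hence "{k. k dvd card V} = {k \<in> {1..card V}. k dvd card V}" by blast
    thus ?thesis by (simp only: sum.inter_filter[OF finite_atLeastAtMost])
  qed
  finally show ?case using insert.hyps by (simp add: sum_distrib_left)
qed

subsection \<open>The recurrence for the orbit polynomials\<close>

text \<open>These are the coefficients of the power series exp(x (s(1) z + s(2) z^2/2 + s(3) z^3/3 +
  ...)) with s = \<open>num_subgroups l\<close>, in the form given by its logarithmic
  derivative.\<close>

fun weighted_count :: "real \<Rightarrow> nat \<Rightarrow> nat \<Rightarrow> real" where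
  "weighted_count x l n = (if n = 0 then 1 else
     x / real n * (\<Sum>k=1..n. real (num_subgroups l k) * weighted_count x l (n - k)))"

declare weighted_count.simps [simp del]

text \<open>The binomial coefficient for the orbit of \<open>v\<close> cancels against the (k-1)!
  from its transitive families and the (n-k)! from the complement. What remains is (n-1)! = n!/n,
  which explains the division by \<open>n\<close> in \<open>weighted_count\<close>.\<close>

lemma orbit_weight_eq:
  fixes V :: "'a set" and I :: "'i set"
  assumes "finite I" "finite V"
  shows "orbit_weight x I V = fact (card V) * weighted_count x (card I) (card V)"
  using assms(2)
proof (induction "card V" arbitrary: V rule: less_induct)
  case less
  show ?case
  proof (cases "V = {}")
    case True
    have "comm_families I {} = {\<lambda>_. id :: 'a \<Rightarrow> 'a}"
      by (auto simp: comm_families_def fun_eq_iff)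
    thus ?thesis using True by (simp add: orbit_weight_def num_orbits_def weighted_count.simps)
  next
    case False
    then obtain v where v: "v \<in> V" by blast
    let ?n = "card V" and ?l = "card I"
    have n0: "?n > 0" using v less by (auto simp: card_gt_0_iff)
    have "orbit_weight x I V = (\<Sum>B | B \<subseteq> V \<and> v \<in> B. (\<lambda>k. x * real (fact (k - 1) * num_subgroups ?l k) *
        (fact (?n - k) * weighted_count x ?l (?n - k))) (card B))"
      unfolding orbit_weight_rec[OF assms(1) less(2) v]
    proof (rule sum.cong[OF refl], clarify)
      fix B assume B: "B \<subseteq> V" "v \<in> B"
      hence fB: "finite B" using less finite_subset by blast
      have c: "card (V - B) = ?n - card B" using B fB by (simp add: card_Diff_subset)
      moreover have "card B > 0" using fB B by (auto simp: card_gt_0_iff)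
      ultimately have "orbit_weight x I (V - B) = fact (?n - card B) * weighted_count x ?l (?n - card B)"
        using less(1)[of "V - B"] less(2) n0 by simp
      thus "x * real (card (trans_families I B v)) * orbit_weight x I (V - B) =
        (\<lambda>k. x * real (fact (k - 1) * num_subgroups ?l k) *
        (fact (?n - k) * weighted_count x ?l (?n - k))) (card B)"
        using card_trans_families[OF assms(1) fB B(2)] by simp
    qed
    also have "\<dots> = (\<Sum>k=1..?n. of_nat ((?n - 1) choose (k - 1)) * (x * real (fact (k - 1) * num_subgroups ?l k) *
        (fact (?n - k) * weighted_count x ?l (?n - k))))"
      by (rule sum_pointed_subsets[OF less(2) v])
    also have "\<dots> = (\<Sum>k=1..?n. fact (?n - 1) * x * (real (num_subgroups ?l k) * weighted_count x ?l (?n - k)))"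
    proof (rule sum.cong[OF refl])
      fix k assume k: "k \<in> {1..?n}"
      have "fact (k - 1) * fact (?n - 1 - (k - 1)) * ((?n - 1) choose (k - 1)) = fact (?n - 1)"
        using k by (intro binomial_fact_lemma) auto
      moreover have "?n - 1 - (k - 1) = ?n - k" using k by auto
      ultimately have *: "real (fact (k - 1) * fact (?n - k) * ((?n - 1) choose (k - 1))) = real (fact (?n - 1))"
        by simp
      have "of_nat ((?n - 1) choose (k - 1)) * (x * real (fact (k - 1) * num_subgroups ?l k) *
        (fact (?n - k) * weighted_count x ?l (?n - k))) =
        real (fact (k - 1) * fact (?n - k) * ((?n - 1) choose (k - 1))) * x *
          (real (num_subgroups ?l k) * weighted_count x ?l (?n - k))" by simp
      thus "of_nat ((?n - 1) choose (k - 1)) * (x * real (fact (k - 1) * num_subgroups ?l k) *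
        (fact (?n - k) * weighted_count x ?l (?n - k))) =
         fact (?n - 1) * x * (real (num_subgroups ?l k) * weighted_count x ?l (?n - k))"
        unfolding * by simp
    qed
    also have "\<dots> = fact ?n * weighted_count x ?l ?n"
      using n0 fact_reduce[OF n0, where ?'a = real]
      by (subst weighted_count.simps[of x ?l ?n]) (simp add: sum_distrib_left mult_ac)
    finally show ?thesis .
  qed
qed

section \<open>From the group-theoretic definitions to padded families\<close>

text \<open>The generated subgroup also contains inverses. They do not leave the forward orbit: it
  is finite, so each \<open>\<sigma> i\<close> permutes it and so does the inverse.\<close>

lemma orb_eq_generate:
  assumes \<sigma>: "\<And>i. i \<in> I \<Longrightarrow> \<sigma> i permutes {1..n}" "\<And>i. i \<notin> I \<Longrightarrow> \<sigma> i = id" and a: "a \<in> {1..n}"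
  shows "orb \<sigma> a = (\<lambda>g. g a) ` generate (sym_group n) (\<sigma> ` I)"
proof
  interpret group "sym_group n" by (rule sym_group_is_group)
  have perm: "\<sigma> i permutes {1..n}" for i using \<sigma> by (cases "i \<in> I") (auto simp: permutes_id)
  show "orb \<sigma> a \<subseteq> (\<lambda>g. g a) ` generate (sym_group n) (\<sigma> ` I)"
  proof (rule orb_least)
    show "a \<in> (\<lambda>g. g a) ` generate (sym_group n) (\<sigma> ` I)"
      using generate.one[of "sym_group n" "\<sigma> ` I"] by (intro image_eqI[of _ _ id]) (simp_all add: sym_group_one)
  next
    fix i b assume "b \<in> (\<lambda>g. g a) ` generate (sym_group n) (\<sigma> ` I)"
    then obtain g where g: "g \<in> generate (sym_group n) (\<sigma> ` I)" "b = g a" by blast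
    show "\<sigma> i b \<in> (\<lambda>g. g a) ` generate (sym_group n) (\<sigma> ` I)"
    proof (cases "i \<in> I")
      case True
      hence "\<sigma> i \<circ> g \<in> generate (sym_group n) (\<sigma> ` I)"
        using generate.eng[OF generate.incl[of "\<sigma> i"] g(1)] by (simp add: sym_group_mult)
      thus ?thesis using g by (intro image_eqI[of _ _ "\<sigma> i \<circ> g"]) auto
    qed (use g \<sigma>(2) in auto)
  qed
  have "g b \<in> orb \<sigma> b" if "g \<in> generate (sym_group n) (\<sigma> ` I)" "b \<in> {1..n}" for g b
    using that
  proof (induction arbitrary: b)
    case one
    show ?case by (simp add: sym_group_one orb_base)
  next
    case (incl h)
    then obtain i where "h = \<sigma> i" by blast
    thus ?case using orb_step[OF orb_base, of \<sigma> i b] by simp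
  next
    case (inv h)
    then obtain i where i: "i \<in> I" "h = \<sigma> i" by blast
    have ph: "h permutes {1..n}" using i \<sigma> by auto
    have inv: "inv\<^bsub>sym_group n\<^esub> h = Hilbert_Choice.inv h"
    proof (rule inv_equality)
      show "Hilbert_Choice.inv h \<otimes>\<^bsub>sym_group n\<^esub> h = \<one>\<^bsub>sym_group n\<^esub>"
        using permutes_inv_o[OF ph] by (simp add: sym_group_mult sym_group_one)
    qed (use ph permutes_inv[OF ph] in \<open>auto simp: sym_group_carrier\<close>)
    have "orb \<sigma> b \<subseteq> {1..n}" by (rule orb_subset_carrier[OF perm inv.prems])
    hence "Hilbert_Choice.inv h b \<in> orb \<sigma> b \<longleftrightarrow> h (Hilbert_Choice.inv h b) \<in> orb \<sigma> b"
      unfolding i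
      by (intro permutes_invariant_iff[symmetric, OF perm] finite_subset[OF _ finite_atLeastAtMost] orb_step)
    thus ?case unfolding inv using permutes_inverses(1)[OF ph] orb_base[of b] by simp
  next
    case (eng g h)
    have "h b \<in> orb \<sigma> b" using eng by auto
    moreover from this have "h b \<in> {1..n}" using orb_subset_carrier[of \<sigma>, OF perm eng.prems] by auto
    ultimately have "g (h b) \<in> orb \<sigma> b"
      using eng.IH(1)[of "h b"] orb_trans[of "h b" \<sigma> b] by (metis subsetD)
    thus ?case by (simp add: sym_group_mult)
  qed
  thus "(\<lambda>g. g a) ` generate (sym_group n) (\<sigma> ` I) \<subseteq> orb \<sigma> a" using a by auto
qed

text \<open>Two families are needed because extensional tuples are \<open>undefined\<close> off the
  index set, while the padded ones are \<open>id\<close> there. Only the values on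
  \<open>{1..l}\<close> enter \<open>kappa\<close>.\<close>

lemma kappa_eq_num_orbits:
  assumes \<sigma>: "\<And>i. i \<in> {1..l} \<Longrightarrow> \<sigma> i permutes {1..n}" "\<And>i. i \<notin> {1..l} \<Longrightarrow> \<sigma> i = id"
    and \<sigma>': "\<And>i. i \<in> {1..l} \<Longrightarrow> \<sigma>' i = \<sigma> i"
  shows "kappa l n \<sigma>' = num_orbits \<sigma> {1..n}"
proof -
  have im: "\<sigma>' ` {1..l} = \<sigma> ` {1..l}" using \<sigma>' by auto
  have "orbit (tuple_subgroup l n \<sigma>') (\<lambda>g. restrict g {1..n}) a = orb \<sigma> a" if "a \<in> {1..n}" for a
    using orb_eq_generate[of "{1..l}" \<sigma> n a] \<sigma> that
    by (auto simp: orbit_def tuple_subgroup_def im[simplified])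
  hence "orbits (tuple_subgroup l n \<sigma>') {1..n} (\<lambda>g. restrict g {1..n}) = orb \<sigma> ` {1..n}"
    unfolding orbits_def Setcompr_eq_image by (rule image_cong[OF refl])
  thus ?thesis by (simp add: kappa_def num_orbits_def)
qed

lemma bij_commuting_tuples:
  "bij_betw (\<lambda>\<sigma> i. if i \<in> {1..l} then \<sigma> i else id) (commuting_tuples l n) (comm_families {1..l} {1..n})"
proof (rule bij_betw_byWitness[where f' = "\<lambda>\<sigma>. restrict \<sigma> {1..l}"], goal_cases)
  case 1
  show ?case by (auto simp: commuting_tuples_def fun_eq_iff PiE_def extensional_def)
next
  case 2
  show ?case by (auto simp: comm_families_def fun_eq_iff)
next
  case 3
  show ?case
    by (auto simp: commuting_tuples_def comm_families_def sym_group_carrier sym_group_mult permutes_id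
        fun_eq_iff PiE_def Pi_def)
next
  case 4
  show ?case
    by (auto simp: commuting_tuples_def comm_families_def sym_group_carrier sym_group_mult fun_eq_iff)
qed

lemma orbit_poly_eq_weighted_count: "orbit_poly l n x = weighted_count x l n"
proof -
  let ?C = "commuting_tuples l n" and ?F = "\<lambda>\<sigma> i. if i \<in> {1..l} then \<sigma> i else (id :: nat \<Rightarrow> nat)"
  have fin: "finite ?C"
    using bij_betw_finite[OF bij_commuting_tuples] finite_comm_families[of "{1..l}" "{1..n}"] by simp
  have kappa: "kappa l n \<sigma> = num_orbits (?F \<sigma>) {1..n}" if "\<sigma> \<in> ?C" for \<sigma>
    using that by (intro kappa_eq_num_orbits) (auto simp: commuting_tuples_def sym_group_carrier)
  have "kappa l n ` ?C \<subseteq> {0..n}"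
    using kappa card_image_le[of "{1..n}"] by (auto simp: num_orbits_def)
  hence "(\<Sum>k=0..n. \<Sum>\<sigma> | \<sigma> \<in> ?C \<and> kappa l n \<sigma> = k. x ^ kappa l n \<sigma>) = (\<Sum>\<sigma>\<in>?C. x ^ kappa l n \<sigma>)"
    by (intro sum.group fin) auto
  moreover have "(\<Sum>\<sigma> | \<sigma> \<in> ?C \<and> kappa l n \<sigma> = k. x ^ kappa l n \<sigma>) = real (commuting_count l n k) * x ^ k" for k
    by (simp add: commuting_count_def)
  moreover have "(\<Sum>\<sigma>\<in>?C. x ^ kappa l n \<sigma>) = orbit_weight x {1..l} {1..n}"
    unfolding orbit_weight_def sum.reindex_bij_betw[OF bij_commuting_tuples, symmetric]
    by (rule sum.cong) (auto simp: kappa)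
  ultimately have "(\<Sum>k=0..n. real (commuting_count l n k) * x ^ k) = orbit_weight x {1..l} {1..n}"
    by (simp only:)
  thus ?thesis by (simp add: orbit_poly_def orbit_weight_eq)
qed

subsection \<open>Abel sums\<close>

definition abel_sum :: "(nat \<Rightarrow> real) \<Rightarrow> real \<Rightarrow> real" where
  "abel_sum f s = (\<Sum>k. f k * exp (- s * real k))"

text \<open>The bound \<open>M\<close> holds for all positive \<open>s\<close>, not just near 0:
  \<open>abel_regular_dirichlet\<close> evaluates at all multiples of \<open>s\<close> and uses
  \<open>M\<close> for domination. The condition at 0 removes a constant term, which would spoil
  this bound for large \<open>s\<close>.\<close>

definition abel_regular :: "(nat \<Rightarrow> real) \<Rightarrow> nat \<Rightarrow> real \<Rightarrow> bool" where
  "abel_regular f p C \<longleftrightarrow> (\<forall>k. f k \<ge> 0) \<and> f 0 = 0 \<and>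
     (\<forall>s>0. summable (\<lambda>k. f k * exp (- s * real k))) \<and>
     (\<exists>M. \<forall>s>0. s ^ p * abel_sum f s \<le> M) \<and>
     ((\<lambda>s. s ^ p * abel_sum f s) \<longlongrightarrow> C) (at_right 0)"

text \<open>Times j!, the coefficient is the product (n+1)...(n+j), whose factors lie between n+1
  and n+j. This compares the series of k^j with a negative binomial series.\<close>

lemma binomial_power_bounds:
  "real (n + 1) ^ j \<le> fact j * real ((n + j) choose j)"
  "fact j * real ((n + j) choose j) \<le> real (n + j) ^ j"
proof -
  have step: "fact (Suc j) * real ((n + Suc j) choose Suc j) = real (n + Suc j) * (fact j * real ((n + j) choose j))" for j
  proof -
    have "Suc (n + j) * ((n + j) choose j) = (Suc (n + j) choose Suc j) * Suc j"
      by (rule Suc_times_binomial_eq)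
    hence "real (Suc (n + j)) * real ((n + j) choose j) = real (Suc (n + j) choose Suc j) * real (Suc j)"
      by (metis of_nat_mult)
    thus ?thesis by (simp add: mult_ac)
  qed
  show "real (n + 1) ^ j \<le> fact j * real ((n + j) choose j)"
  proof (induction j)
    case (Suc j)
    have "real (n + 1) ^ Suc j \<le> real (n + Suc j) * (fact j * real ((n + j) choose j))"
      unfolding power_Suc by (intro mult_mono Suc.IH) auto
    thus ?case unfolding step .
  qed auto
  show "fact j * real ((n + j) choose j) \<le> real (n + j) ^ j"
  proof (induction j)
    case (Suc j)
    have "real (n + Suc j) * (fact j * real ((n + j) choose j)) \<le> real (n + Suc j) * real (n + j) ^ j"
      by (intro mult_left_mono Suc.IH) auto
    also have "\<dots> \<le> real (n + Suc j) * real (n + Suc j) ^ j"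
      by (intro mult_left_mono power_mono) auto
    finally show ?case unfolding step by simp
  qed auto
qed

lemma negative_binomial_sums:
  fixes q :: real
  assumes "0 < q" "q < 1"
  shows "(\<lambda>n. real ((n + j) choose j) * q ^ n) sums (1 / (1 - q) ^ Suc j)"
proof -
  have "(\<lambda>n. ((- real (Suc j)) gchoose n) * (- q) ^ n) sums (1 + (- q)) powr (- real (Suc j))"
    by (rule gen_binomial_real) (use assms in auto)
  moreover have "((- real (Suc j)) gchoose n) * (- q) ^ n = real ((n + j) choose j) * q ^ n" for n
  proof -
    have "((- real (Suc j)) gchoose n) = (- 1) ^ n * (real (n + j) gchoose n)"
      by (subst gbinomial_minus) (simp add: add_ac)
    also have "real (n + j) gchoose n = real ((n + j) choose j)"
      using binomial_symmetric[of j "n + j"] binomial_gbinomial[of "n + j" n, where ?'a = real] by simp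
    finally show ?thesis by (simp add: power_mult_distrib[symmetric])
  qed
  moreover have "(1 + (- q)) powr (- real (Suc j)) = 1 / (1 - q) ^ Suc j"
    using assms by (subst powr_minus, subst powr_realpow) (auto simp: field_simps)
  ultimately show ?thesis by simp
qed

text \<open>With q = exp(-s), the two binomial bounds enclose the Abel sum between j!
  q^j/(1-q)^(j+1) - 1 and j! q/(1-q)^(j+1); both ends behave like j!/s^(j+1) as s tends to
  0.\<close>

lemma abel_regular_power:
  "abel_regular (\<lambda>k. if k = 0 then 0 else real k ^ j) (Suc j) (fact j)"
proof -
  let ?f = "\<lambda>k. if k = 0 then 0 else real k ^ j"
  have main: "summable (\<lambda>k. ?f k * exp (- s * real k)) \<and>
      abel_sum ?f s \<le> fact j * exp (- s) / (1 - exp (- s)) ^ Suc j \<and>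
      fact j * exp (- s) ^ j / (1 - exp (- s)) ^ Suc j - 1 \<le> abel_sum ?f s" if s: "s > 0" for s :: real
  proof -
    define q where "q = exp (- s)"
    have q: "0 < q" "q < 1" using s by (auto simp: q_def)
    have eq: "exp (- s * real k) = q ^ k" for k
      unfolding q_def by (metis exp_of_nat2_mult)
    note B = negative_binomial_sums[OF q, of j]
    have B1: "(\<lambda>n. fact j * q * (real ((n + j) choose j) * q ^ n)) sums (fact j * q * (1 / (1 - q) ^ Suc j))"
      by (rule sums_mult[OF B])
    have le1: "?f (Suc n) * q ^ Suc n \<le> fact j * q * (real ((n + j) choose j) * q ^ n)" for n
      using mult_right_mono[OF binomial_power_bounds(1)[of n j], of "q ^ Suc n"] q by (simp add: mult_ac)
    have sm1: "summable (\<lambda>n. ?f (Suc n) * q ^ Suc n)"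
      by (rule summable_comparison_test'[OF sums_summable[OF B1], of 0])
        (use le1 q in \<open>auto simp del: power_Suc\<close>)
    hence sm: "summable (\<lambda>k. ?f k * q ^ k)"
      by (subst summable_Suc_iff[symmetric])
    have nn: "?f k * q ^ k \<ge> 0" for k using q by auto
    have "(\<Sum>k. ?f k * q ^ k) = (\<Sum>n. ?f (Suc n) * q ^ Suc n)"
      using suminf_split_head[OF sm] by simp
    also have "\<dots> \<le> fact j * q * (1 / (1 - q) ^ Suc j)"
      using suminf_le[OF le1 sm1 sums_summable[OF B1]] sums_unique[OF B1] by simp
    finally have up: "(\<Sum>k. ?f k * q ^ k) \<le> fact j * q / (1 - q) ^ Suc j" by simp
    have B2: "(\<lambda>n. fact j * q ^ j * (real ((n + j) choose j) * q ^ n)) sums (fact j * q ^ j * (1 / (1 - q) ^ Suc j))"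
      by (rule sums_mult[OF B])
    \<comment> \<open>The correction at \<open>n = 0\<close> matters only for \<open>j = 0\<close>:
      there \<open>0 ^ 0 = 1\<close>, but \<open>?f\<close> is 0 at 0.\<close>
    have le2: "fact j * q ^ j * (real ((n + j) choose j) * q ^ n) \<le> ?f (n + j) * q ^ (n + j) + (if n = 0 then 1 else 0)" for n
    proof -
      have "fact j * q ^ j * (real ((n + j) choose j) * q ^ n) \<le> real (n + j) ^ j * q ^ (n + j)"
        using mult_right_mono[OF binomial_power_bounds(2)[of j n], of "q ^ (n + j)"] q
        by (simp add: mult_ac power_add)
      also have "\<dots> \<le> ?f (n + j) * q ^ (n + j) + (if n = 0 then 1 else 0)"
        by (cases "n + j = 0") auto
      finally show ?thesis .
    qed
    have sm2: "summable (\<lambda>n. ?f (n + j) * q ^ (n + j))" using sm by (subst summable_iff_shift)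
    have one: "(\<lambda>n::nat. if n = 0 then 1 else 0 :: real) sums 1"
      using sums_single[of 0 "\<lambda>_. 1 :: real"] by simp
    have "fact j * q ^ j * (1 / (1 - q) ^ Suc j) \<le> (\<Sum>n. ?f (n + j) * q ^ (n + j)) + 1"
      using sums_le[OF le2 B2 sums_add[OF summable_sums[OF sm2] one]] .
    also have "(\<Sum>n. ?f (n + j) * q ^ (n + j)) \<le> (\<Sum>k. ?f k * q ^ k)"
      using suminf_split_initial_segment[OF sm, of j] nn by (simp add: sum_nonneg)
    finally show ?thesis using sm up unfolding abel_sum_def eq by (simp add: q_def)
  qed
  \<comment> \<open>The bound for all s comes from s/(1-exp(-s)) \<le> 1+s \<le> (j+1) exp(s/(j+1)):
    the power j+1 of the right side grows like exp(s), which the factor exp(-s) of the upper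
    estimate absorbs.\<close>
  have bd: "s ^ Suc j * abel_sum ?f s \<le> fact j * real (Suc j) ^ Suc j" if s: "s > 0" for s
  proof -
    have q1: "1 - exp (- s) > 0" using s by simp
    have "(1 + s) * exp (- s) \<le> 1"
      using exp_ge_add_one_self[of s] by (simp add: exp_minus field_simps)
    hence "s \<le> (1 + s) * (1 - exp (- s))" by (simp add: algebra_simps)
    hence "s / (1 - exp (- s)) \<le> 1 + s" using q1 by (simp add: field_simps)
    also have "1 + s \<le> real (Suc j) * (1 + s / real (Suc j))" using s by (simp add: field_simps)
    also have "\<dots> \<le> real (Suc j) * exp (s / real (Suc j))"
      using exp_ge_add_one_self[of "s / real (Suc j)"] by (intro mult_left_mono) auto
    finally have "(s / (1 - exp (- s))) ^ Suc j \<le> (real (Suc j) * exp (s / real (Suc j))) ^ Suc j"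
      using s q1 by (intro power_mono) auto
    also have "\<dots> = real (Suc j) ^ Suc j * exp s"
      by (simp only: power_mult_distrib exp_divide_power_eq[OF zero_less_Suc])
    finally have "(s / (1 - exp (- s))) ^ Suc j * exp (- s) \<le> real (Suc j) ^ Suc j * exp s * exp (- s)"
      by (rule mult_right_mono) simp
    hence *: "(s / (1 - exp (- s))) ^ Suc j * exp (- s) \<le> real (Suc j) ^ Suc j"
      by (simp only: mult.assoc exp_minus_inverse mult_1_right)
    have "s ^ Suc j * abel_sum ?f s \<le> s ^ Suc j * (fact j * exp (- s) / (1 - exp (- s)) ^ Suc j)"
      using main[OF s] s by (intro mult_left_mono) auto
    also have "\<dots> = fact j * ((s / (1 - exp (- s))) ^ Suc j * exp (- s))"
      by (simp add: power_divide)
    also have "\<dots> \<le> fact j * real (Suc j) ^ Suc j" by (intro mult_left_mono *) auto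
    finally show ?thesis .
  qed
  have lim: "((\<lambda>s. s ^ Suc j * abel_sum ?f s) \<longlongrightarrow> fact j) (at_right 0)"
  proof (rule tendsto_sandwich)
    have r: "((\<lambda>s::real. s / (1 - exp (- s))) \<longlongrightarrow> 1) (at_right 0)" by real_asymp
    have e: "((\<lambda>s::real. exp (- s)) \<longlongrightarrow> 1) (at_right 0)" by real_asymp
    have "((\<lambda>s::real. fact j * exp (- s) ^ j * (s / (1 - exp (- s))) ^ Suc j - s ^ Suc j) \<longlongrightarrow>
        fact j * 1 ^ j * 1 ^ Suc j - 0 ^ Suc j) (at_right 0)"
      by (intro tendsto_diff tendsto_mult tendsto_const tendsto_power r e tendsto_ident_at)
    also have "fact j * 1 ^ j * 1 ^ Suc j - 0 ^ Suc j = (fact j :: real)" by simp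
    finally show "((\<lambda>s::real. fact j * exp (- s) ^ j * (s / (1 - exp (- s))) ^ Suc j - s ^ Suc j) \<longlongrightarrow> fact j) (at_right 0)" .
    show "((\<lambda>s::real. fact j * exp (- s) * (s / (1 - exp (- s))) ^ Suc j) \<longlongrightarrow> fact j) (at_right 0)"
      using tendsto_mult[OF tendsto_mult[OF tendsto_const[of "fact j"] e] tendsto_power[OF r, of "Suc j"]] by simp
    show "\<forall>\<^sub>F s in at_right 0. fact j * exp (- s) ^ j * (s / (1 - exp (- s))) ^ Suc j - s ^ Suc j \<le> s ^ Suc j * abel_sum ?f s"
      using eventually_at_right_less[of "0::real"]
    proof eventually_elim
      case (elim s)
      have "s ^ Suc j * (fact j * exp (- s) ^ j / (1 - exp (- s)) ^ Suc j - 1) \<le> s ^ Suc j * abel_sum ?f s"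
        using main[OF elim] elim by (intro mult_left_mono) auto
      thus ?case by (simp add: right_diff_distrib power_divide mult_ac)
    qed
    show "\<forall>\<^sub>F s in at_right 0. s ^ Suc j * abel_sum ?f s \<le> fact j * exp (- s) * (s / (1 - exp (- s))) ^ Suc j"
      using eventually_at_right_less[of "0::real"]
    proof eventually_elim
      case (elim s)
      have "s ^ Suc j * abel_sum ?f s \<le> s ^ Suc j * (fact j * exp (- s) / (1 - exp (- s)) ^ Suc j)"
        using main[OF elim] elim by (intro mult_left_mono) auto
      thus ?case by (simp add: power_divide mult_ac)
    qed
  qed
  show ?thesis unfolding abel_regular_def using main bd lim by auto
qed

section \<open>Divisor sums and zeta values\<close>

text \<open>Expanding the outer series gives a double series over (n, k), which is regrouped by m =
  (n+1) k. All terms are nonnegative, so unconditional summation over the pairs justifies the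
  exchange.\<close>

lemma abel_sum_dirichlet:
  fixes f :: "nat \<Rightarrow> real"
  assumes nn: "\<And>k. f k \<ge> 0" and f0: "f 0 = 0"
    and sm: "\<And>s. s > 0 \<Longrightarrow> summable (\<lambda>k. f k * exp (- s * real k))"
    and s: "s > 0" and outer: "summable (\<lambda>n. real (Suc n) ^ r * abel_sum f (s * real (Suc n)))"
  shows "(\<lambda>m. (\<Sum>k | k dvd m. real (m div k) ^ r * f k) * exp (- s * real m)) sums
           (\<Sum>n. real (Suc n) ^ r * abel_sum f (s * real (Suc n)))"
proof -
  let ?S = "\<Sum>n. real (Suc n) ^ r * abel_sum f (s * real (Suc n))"
  define h where "h = (\<lambda>(n, k). real (Suc n) ^ r * (f k * exp (- (s * real (Suc n)) * real k)))"
  have F0: "abel_sum f t \<ge> 0" if "t > 0" for t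
    unfolding abel_sum_def by (intro suminf_nonneg sm that) (simp add: nn)
  have inner: "((\<lambda>k. h (n, k)) has_sum real (Suc n) ^ r * abel_sum f (s * real (Suc n))) {1..}" for n
  proof -
    have "s * real (Suc n) > 0" using s by simp
    from summable_sums[OF sm[OF this]]
    have "((\<lambda>k. f k * exp (- (s * real (Suc n)) * real k)) has_sum abel_sum f (s * real (Suc n))) UNIV"
      unfolding abel_sum_def by (rule sums_nonneg_imp_has_sum) (simp add: nn)
    hence "((\<lambda>k. h (n, k)) has_sum real (Suc n) ^ r * abel_sum f (s * real (Suc n))) UNIV"
      unfolding h_def prod.case by (rule has_sum_cmult_right)
    \<comment> \<open>Dropping \<open>k = 0\<close> makes the map from (n, k) to ((n+1) k, k) a
      bijection onto the pairs of a positive m and a divisor of it.\<close>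
    also have "?this \<longleftrightarrow> ?thesis"
      by (rule has_sum_cong_neutral) (auto simp: h_def f0 not_le)
    finally show ?thesis .
  qed
  have out: "((\<lambda>n. real (Suc n) ^ r * abel_sum f (s * real (Suc n))) has_sum ?S) UNIV"
    by (rule sums_nonneg_imp_has_sum[OF summable_sums[OF outer]]) (use F0 s in simp)
  have "(h has_sum ?S) (UNIV \<times> {1..})"
  proof (rule has_sum_SigmaI[OF inner out])
    show "h summable_on UNIV \<times> {1..}"
      by (rule summable_on_SigmaI[OF inner has_sum_imp_summable[OF out]]) (auto simp: h_def nn)
  qed
  also have "?this \<longleftrightarrow> ((\<lambda>(m, k). real (m div k) ^ r * f k * exp (- s * real m)) has_sum ?S)
      (Sigma {1..} (\<lambda>m. {k. k dvd m}))"
  proof (rule has_sum_reindex_bij_witness[where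
        i = "\<lambda>(m, k). (m div k - 1, k)" and j = "\<lambda>(n, k). (Suc n * k, k)"], goal_cases)
    case (2 a) thus ?case by (cases a) (auto simp: Suc_le_eq simp del: mult_Suc)
  next
    case (5 a) thus ?case by (auto simp: h_def algebra_simps)
  qed (auto simp: dvd_def Suc_le_eq mult.commute simp del: mult_Suc mult_Suc_right)
  finally have "((\<lambda>m. (\<Sum>k | k dvd m. real (m div k) ^ r * f k) * exp (- s * real m)) has_sum ?S) {1..}"
  proof (rule has_sum_SigmaD)
    fix m :: nat assume "m \<in> {1..}"
    hence "finite {k. k dvd m}" by simp
    thus "((\<lambda>k. case (m, k) of (m, k) \<Rightarrow> real (m div k) ^ r * f k * exp (- s * real m)) has_sum
      (\<Sum>k | k dvd m. real (m div k) ^ r * f k) * exp (- s * real m)) {k. k dvd m}"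
      by (auto simp: sum_distrib_right intro: has_sum_finiteI)
  qed
  \<comment> \<open>The term at \<open>m = 0\<close> vanishes, since 0 has infinitely many divisors
    and the sum over an infinite set is 0.\<close>
  also have "?this \<longleftrightarrow> ((\<lambda>m. (\<Sum>k | k dvd m. real (m div k) ^ r * f k) * exp (- s * real m)) has_sum ?S) UNIV"
    by (rule has_sum_cong_neutral) (auto simp: not_le)
  finally show ?thesis by (rule has_sum_imp_sums)
qed

text \<open>With G(u) = u^p \<open>abel_sum f u\<close>, the scaled sum is the series of G(s (n+1))
  / (n+1)^(p-r). Here G is bounded and tends to \<open>C\<close> at 0, and
  \<open>r + 2 \<le> p\<close> makes the majorant converge, so Tannery's theorem applies.\<close>

lemma abel_regular_dirichlet:
  assumes f: "abel_regular f p C" and r: "r + 2 \<le> p"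
  shows "abel_regular (\<lambda>m. \<Sum>k | k dvd m. real (m div k) ^ r * f k) p
           (C * (\<Sum>n. 1 / real (Suc n) ^ (p - r)))"
proof -
  let ?g = "\<lambda>m. \<Sum>k | k dvd m. real (m div k) ^ r * f k"
  let ?z = "\<lambda>n. 1 / real (Suc n) ^ (p - r)"
  let ?G = "\<lambda>s. s ^ p * abel_sum f s"
  have nn: "\<And>k. f k \<ge> 0" and f0: "f 0 = 0"
    and sm: "\<And>s. s > 0 \<Longrightarrow> summable (\<lambda>k. f k * exp (- s * real k))"
    and lim: "(?G \<longlongrightarrow> C) (at_right 0)"
    using f by (auto simp: abel_regular_def)
  obtain M where M: "\<And>s. s > 0 \<Longrightarrow> ?G s \<le> M" using f by (auto simp: abel_regular_def)
  have sz: "summable ?z"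
    using inverse_power_summable[of "p - r", where ?'a = real] r
    by (subst summable_Suc_iff[of "\<lambda>n. 1 / real n ^ (p - r)"]) (simp_all add: inverse_eq_divide)
  have F0: "abel_sum f t \<ge> 0" if "t > 0" for t
    unfolding abel_sum_def by (intro suminf_nonneg sm that) (simp add: nn)
  have term_eq: "s ^ p * (real (Suc n) ^ r * abel_sum f (s * real (Suc n))) = ?G (s * real (Suc n)) * ?z n" for s n
  proof -
    have "real (Suc n) ^ p = real (Suc n) ^ r * real (Suc n) ^ (p - r)"
      using r by (simp only: power_add[symmetric]) simp
    thus ?thesis by (simp add: power_mult_distrib field_simps del: of_nat_Suc)
  qed
  have bound: "\<bar>?G (s * real (Suc n)) * ?z n\<bar> \<le> M * ?z n" if "s > 0" for s n
  proof -
    have "s * real (Suc n) > 0" using that by simp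
    from M[OF this] F0[OF this] this show ?thesis
      by (simp add: abs_mult divide_right_mono del: of_nat_Suc)
  qed
  have outer: "summable (\<lambda>n. ?G (s * real (Suc n)) * ?z n)" if "s > 0" for s
    by (rule summable_comparison_test'[OF summable_mult[OF sz, of M], of 0])
      (use bound[OF that] in \<open>simp del: of_nat_Suc\<close>)
  have outer': "summable (\<lambda>n. real (Suc n) ^ r * abel_sum f (s * real (Suc n)))" if s: "s > 0" for s
  proof -
    have "summable (\<lambda>n. s ^ p * (real (Suc n) ^ r * abel_sum f (s * real (Suc n))))"
      unfolding term_eq by (rule outer[OF s])
    thus ?thesis using s by (simp add: summable_cmult_iff del: of_nat_Suc)
  qed
  have sums: "(\<lambda>m. ?g m * exp (- s * real m)) sums (\<Sum>n. real (Suc n) ^ r * abel_sum f (s * real (Suc n)))"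
    if "s > 0" for s by (rule abel_sum_dirichlet[OF nn f0 sm that outer'[OF that]])
  have eq: "s ^ p * abel_sum ?g s = (\<Sum>n. ?G (s * real (Suc n)) * ?z n)" if "s > 0" for s
    using suminf_mult[OF outer'[OF that], of "s ^ p"]
    unfolding term_eq abel_sum_def[of ?g] sums_unique[OF sums[OF that], symmetric] by simp
  have "((\<lambda>s. \<Sum>n. ?G (s * real (Suc n)) * ?z n) \<longlongrightarrow> (\<Sum>n. C * ?z n)) (at_right 0)"
  proof (rule tannerys_theorem[THEN conjunct2, THEN conjunct2])
    fix n
    have "filterlim (\<lambda>s. s * real (Suc n)) (at_right 0) (at_right 0)"
      by real_asymp
    from filterlim_compose[OF lim this]
    show "((\<lambda>s. ?G (s * real (Suc n)) * ?z n) \<longlongrightarrow> C * ?z n) (at_right 0)"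
      by (intro tendsto_mult tendsto_const)
  next
    have "\<forall>\<^sub>F (n::nat, s) in at_top \<times>\<^sub>F at_right (0::real). s > 0"
      using eventually_prod2[of "at_top :: nat filter" "\<lambda>s::real. s > 0" "at_right 0"]
        eventually_at_right_less[of "0::real"] by simp
    thus "\<forall>\<^sub>F (n, s) in at_top \<times>\<^sub>F at_right 0. norm (?G (s * real (Suc n)) * ?z n) \<le> M * ?z n"
      by eventually_elim (use bound in \<open>auto simp del: of_nat_Suc\<close>)
    show "summable (\<lambda>n. M * ?z n)" by (rule summable_mult[OF sz])
    show "at_right (0::real) \<noteq> bot" by simp
  qed
  also have "(\<Sum>n. C * ?z n) = C * (\<Sum>n. ?z n)" by (rule suminf_mult[OF sz])
  finally have lim': "((\<lambda>s. s ^ p * abel_sum ?g s) \<longlongrightarrow> C * (\<Sum>n. ?z n)) (at_right 0)"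
    by (rule Lim_transform_eventually) (use eventually_at_right_less[of "0::real"] in
        \<open>eventually_elim, simp only: eq\<close>)
  have "s ^ p * abel_sum ?g s \<le> (\<Sum>n. M * ?z n)" if "s > 0" for s
    unfolding eq[OF that] using bound[OF that]
    by (intro suminf_le outer[OF that] summable_mult[OF sz]) (metis abs_le_D1)
  moreover have "?g m \<ge> 0" for m by (intro sum_nonneg mult_nonneg_nonneg nn) auto
  ultimately show ?thesis
    unfolding abel_regular_def using lim' sums_summable[OF sums] by auto
qed

text \<open>Multiplying the divisor recursion by m^j gives m^j = (m/k)^j k^j inside the sum, so the
  case (l+1, j) follows from (l, j+1) by \<open>abel_regular_dirichlet\<close> with p - r = l+2, the
  argument of the new zeta factor. The sum l+j is preserved, hence the factorial stays fixed; in the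
  base case the count is 1 at every positive k.\<close>

lemma abel_regular_num_subgroups:
  "abel_regular (\<lambda>k. real k ^ j * real (num_subgroups (Suc l) k)) (Suc l + j)
     (fact (l + j) * (\<Prod>i=2..Suc l. riemann_zeta (real i)))"
proof (induction l arbitrary: j)
  case 0
  have "num_subgroups (Suc 0) k = (if k = 0 then 0 else 1)" for k
  proof (cases "k = 0")
    case False
    have "(\<Sum>d | d dvd k. d * (if d = 1 then 1 else 0)) = (\<Sum>d | d dvd k. if d = 1 then 1 else 0 :: nat)"
      by (rule sum.cong) auto
    also have "\<dots> = 1" using False by (subst sum.delta) auto
    finally show ?thesis using False by simp
  qed simp
  hence "(\<lambda>k. real k ^ j * real (num_subgroups (Suc 0) k)) = (\<lambda>k. if k = 0 then 0 else real k ^ j)"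
    by (simp add: fun_eq_iff del: num_subgroups.simps)
  thus ?case using abel_regular_power[of j] by (simp del: num_subgroups.simps)
next
  case (Suc l)
  let ?f = "\<lambda>k. real k ^ Suc j * real (num_subgroups (Suc l) k)"
  have "(\<Sum>k | k dvd m. real (m div k) ^ j * ?f k) = real m ^ j * real (num_subgroups (Suc (Suc l)) m)" for m
  proof -
    have "real (m div k) ^ j * ?f k = real m ^ j * real (k * num_subgroups (Suc l) k)" if "k dvd m" for k
    proof -
      have "real (m div k) * real k = real m" using that by (metis dvd_div_mult_self of_nat_mult)
      hence "real m ^ j = real (m div k) ^ j * real k ^ j" by (metis power_mult_distrib)
      thus ?thesis by (simp add: mult_ac del: num_subgroups.simps)
    qed
    thus ?thesis
      unfolding num_subgroups.simps(2)[of "Suc l"] of_nat_sum sum_distrib_left by (intro sum.cong) auto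
  qed
  moreover have "(\<Sum>n. 1 / real (Suc n) ^ (Suc l + Suc j - j)) = riemann_zeta (real (Suc (Suc l)))"
    unfolding riemann_zeta_def by (subst powr_realpow) (auto simp: add.commute)
  moreover have "(\<Prod>i=2..Suc (Suc l). riemann_zeta (real i)) =
      (\<Prod>i=2..Suc l. riemann_zeta (real i)) * riemann_zeta (real (Suc (Suc l)))"
    by simp
  ultimately show ?case
    using abel_regular_dirichlet[OF Suc.IH[of "Suc j"], of j] by (simp del: num_subgroups.simps of_nat_Suc prod.cl_ivl_Suc add: mult_ac)
qed

subsection \<open>Asymptotics of the recurrence\<close>

text \<open>Concavity in the form of the weighted mean inequality for \<open>b / a\<close> and 1.
  The value \<open>b = 0\<close> is included because the recurrence reaches
  \<open>n - k = 0\<close>.\<close>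

lemma powr_le_tangent:
  fixes \<beta> a b :: real
  assumes "0 < \<beta>" "\<beta> < 1" "a > 0" "b \<ge> 0"
  shows "b powr \<beta> \<le> a powr \<beta> + \<beta> * a powr (\<beta> - 1) * (b - a)"
proof (cases "b = 0")
  case True
  have "a powr \<beta> = a powr (\<beta> - 1) * a" using assms by (simp add: powr_diff)
  thus ?thesis using assms True by (simp add: mult_le_cancel_right1)
next
  case False
  have "(b / a) powr \<beta> * 1 powr (1 - \<beta>) \<le> \<beta> * (b / a) + (1 - \<beta>) * 1"
    by (rule Youngs_inequality_0) (use assms False in auto)
  hence "(b / a) powr \<beta> \<le> 1 + \<beta> * (b / a - 1)" by (simp add: algebra_simps)
  hence "a powr \<beta> * (b / a) powr \<beta> \<le> a powr \<beta> * (1 + \<beta> * (b / a - 1))"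
    by (intro mult_left_mono) auto
  moreover have "a powr \<beta> * (b / a) powr \<beta> = b powr \<beta>"
    using assms by (simp add: powr_divide)
  moreover have "a powr \<beta> * (1 + \<beta> * (b / a - 1)) = a powr \<beta> + \<beta> * a powr (\<beta> - 1) * (b - a)"
    using assms by (simp add: powr_diff field_simps)
  ultimately show ?thesis by simp
qed

locale convolution_recurrence =
  fixes a h :: "nat \<Rightarrow> real" and x K :: real and l :: nat
  assumes reg: "abel_regular a l K" and K: "K > 0" and x: "x > 0" and l: "l \<ge> 2"
    and h_pos: "\<And>n. h n > 0"
    and rec: "\<And>n. n > 0 \<Longrightarrow> real n * h n = x * (\<Sum>k=1..n. a k * h (n - k))"
begin

definition \<beta> :: real where "\<beta> = (real l - 1) / real l"

lemma beta: "0 < \<beta>" "\<beta> < 1" "\<beta> - 1 = - 1 / real l"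
  using l by (auto simp: \<beta>_def field_simps)

lemma a_nonneg: "a k \<ge> 0"
  and abel_sum_summable: "s > 0 \<Longrightarrow> summable (\<lambda>k. a k * exp (- s * real k))"
  and abel_sum_limit: "((\<lambda>s. s ^ l * abel_sum a s) \<longlongrightarrow> K) (at_right 0)"
  using reg by (auto simp: abel_regular_def)

lemma scale_power: "n > 0 \<Longrightarrow> (u * real n powr (\<beta> - 1)) ^ l * real n = u ^ l"
proof -
  assume n: "n > 0"
  have "(real n powr (\<beta> - 1)) ^ l = real n powr (- 1)"
    using n l by (simp add: powr_realpow[symmetric] powr_powr beta(3))
  thus ?thesis using n by (simp add: power_mult_distrib powr_minus)
qed

lemma scale_tendsto: "u > 0 \<Longrightarrow> filterlim (\<lambda>n. u * real n powr (\<beta> - 1)) (at_right 0) sequentially"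
proof -
  assume u: "u > 0"
  have "((\<lambda>n. u * real n powr (\<beta> - 1)) \<longlongrightarrow> u * 0) sequentially"
    by (intro tendsto_mult tendsto_const tendsto_neg_powr filterlim_real_sequentially) (use beta(2) in simp)
  moreover have "\<forall>\<^sub>F n in sequentially. u * real n powr (\<beta> - 1) > 0"
    using eventually_gt_at_top[of 0] by eventually_elim (use u in simp)
  ultimately show ?thesis by (intro tendsto_imp_filterlim_at_right) simp_all
qed

text \<open>With \<open>t = u n\<^sup>\<beta>\<^sup>-\<^sup>1\<close> one has \<open>t\<^sup>l n = u\<^sup>l\<close>, which turns the induction step into a comparison of
  \<open>x t\<^sup>l (abel_sum a t)\<close> with \<open>u\<^sup>l\<close>.\<close>

lemma upper_bound:
  assumes c: "c > 0" and large: "x * K < (c * \<beta>) ^ l"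
  shows "\<exists>D. \<forall>n. h n \<le> D * exp (c * real n powr \<beta>)"
proof -
  define t where "t = (\<lambda>n. c * \<beta> * real n powr (\<beta> - 1))"
  have "((\<lambda>n. x * (t n ^ l * abel_sum a (t n))) \<longlongrightarrow> x * K) sequentially"
    unfolding t_def using c beta
    by (intro tendsto_mult tendsto_const filterlim_compose[OF abel_sum_limit] scale_tendsto) auto
  hence "\<forall>\<^sub>F n in sequentially. x * (t n ^ l * abel_sum a (t n)) < (c * \<beta>) ^ l"
    using large by (rule order_tendstoD)
  then obtain N where N: "\<And>n. n \<ge> N \<Longrightarrow> x * (t n ^ l * abel_sum a (t n)) < (c * \<beta>) ^ l"
    by (auto simp: eventually_sequentially)
  \<comment> \<open>The recurrence is linear, so the induction step works for any nonnegative
    \<open>D\<close>; this one settles the indices up to \<open>N\<close>.\<close>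
  define D where "D = (\<Sum>k\<le>N. h k)"
  have "h n \<le> D * exp (c * real n powr \<beta>)" for n
  proof (induction n rule: less_induct)
    case (less n)
    show ?case
    proof (cases "n \<le> N")
      case True
      have "h n \<le> D" unfolding D_def using True h_pos by (intro member_le_sum) (auto intro: less_imp_le)
      moreover have "D * 1 \<le> D * exp (c * real n powr \<beta>)"
        using c h_pos by (intro mult_left_mono) (auto simp: D_def intro: sum_nonneg less_imp_le)
      ultimately show ?thesis by simp
    next
      case False
      hence n: "n > 0" "n \<ge> N" by auto
      let ?E = "exp (c * real n powr \<beta>)"
      have tpos: "t n > 0" using n c beta by (simp add: t_def)
      have D0: "D \<ge> 0" using h_pos by (auto simp: D_def intro: sum_nonneg less_imp_le)
      have "h (n - k) \<le> D * ?E * exp (- t n * real k)" if k: "k \<in> {1..n}" for k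
      proof -
        have "real (n - k) powr \<beta> \<le> real n powr \<beta> + \<beta> * real n powr (\<beta> - 1) * (real (n - k) - real n)"
          using n beta by (intro powr_le_tangent) auto
        hence "c * real (n - k) powr \<beta> \<le> c * (real n powr \<beta> + \<beta> * real n powr (\<beta> - 1) * (real (n - k) - real n))"
          using c by (intro mult_left_mono) auto
        also have "\<dots> = c * real n powr \<beta> + - t n * real k"
          using k by (simp add: t_def of_nat_diff algebra_simps)
        finally have "exp (c * real (n - k) powr \<beta>) \<le> ?E * exp (- t n * real k)"
          by (simp add: exp_add[symmetric])
        hence "D * exp (c * real (n - k) powr \<beta>) \<le> D * (?E * exp (- t n * real k))"
          using D0 by (rule mult_left_mono)
        moreover have "h (n - k) \<le> D * exp (c * real (n - k) powr \<beta>)"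
          using less.IH[of "n - k"] k by auto
        ultimately show ?thesis by simp
      qed
      hence "(\<Sum>k=1..n. a k * h (n - k)) \<le> (\<Sum>k=1..n. a k * (D * ?E * exp (- t n * real k)))"
        by (intro sum_mono mult_left_mono a_nonneg)
      also have "\<dots> = D * ?E * (\<Sum>k=1..n. a k * exp (- t n * real k))"
        by (simp add: sum_distrib_left mult_ac)
      also have "\<dots> \<le> D * ?E * abel_sum a (t n)"
        unfolding abel_sum_def using D0 a_nonneg
        by (intro mult_left_mono sum_le_suminf abel_sum_summable tpos) auto
      finally have "real n * h n \<le> x * (D * ?E * abel_sum a (t n))"
        unfolding rec[OF n(1)] using x by (intro mult_left_mono) auto
      also have "x * abel_sum a (t n) \<le> real n"
      proof -
        have "t n ^ l * (x * abel_sum a (t n)) \<le> t n ^ l * real n"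
          using N[OF n(2)] scale_power[OF n(1), of "c * \<beta>"] by (simp add: t_def mult_ac)
        thus ?thesis using tpos by (simp add: mult_le_cancel_left)
      qed
      hence "D * ?E * (x * abel_sum a (t n)) \<le> D * ?E * real n"
        using D0 by (intro mult_left_mono) auto
      hence "x * (D * ?E * abel_sum a (t n)) \<le> real n * (D * ?E)" by (simp add: mult_ac)
      finally show ?thesis using n by simp
    qed
  qed
  thus ?thesis by blast
qed

text \<open>The linear bound on \<open>n\<^sup>\<beta> - (n-k)\<^sup>\<beta>\<close> holds up to a factor \<open>1/(1-\<epsilon>)\<close> for \<open>k \<le> \<epsilon> n\<close>; the terms with
  \<open>k > \<epsilon> n\<close> are bounded by \<open>exp (-t \<epsilon> n / 2) abel_sum a (t/2)\<close>, which is negligible.\<close>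

lemma lower_bound:
  assumes c: "c > 0" and small: "(c * \<beta>) ^ l < x * K"
  shows "\<exists>D>0. \<forall>n. D * exp (c * real n powr \<beta>) \<le> h n"
proof -
  \<comment> \<open>The strict inequality \<open>small\<close> leaves room to enlarge the slope by
    \<open>1 / (1 - \<epsilon>)\<close> and stay below \<open>x * K\<close>.\<close>
  have "((\<lambda>\<epsilon>. (c * \<beta> / (1 - \<epsilon>)) ^ l) \<longlongrightarrow> (c * \<beta> / (1 - 0)) ^ l) (at_right 0)"
    by (intro tendsto_intros) auto
  hence "\<forall>\<^sub>F \<epsilon> in at_right 0. (c * \<beta> / (1 - \<epsilon>)) ^ l < x * K"
    using small by (intro order_tendstoD) auto
  moreover have "\<forall>\<^sub>F \<epsilon>::real in at_right 0. \<epsilon> \<in> {0<..<1}" by (rule eventually_at_right_real) simp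
  ultimately obtain \<epsilon> where \<epsilon>: "(c * \<beta> / (1 - \<epsilon>)) ^ l < x * K" "0 < \<epsilon>" "\<epsilon> < 1"
    using eventually_happens'[OF trivial_limit_at_right_real eventually_conj] by fastforce
  define u where "u = c * \<beta> / (1 - \<epsilon>)"
  have u: "u > 0" using c beta \<epsilon> by (simp add: u_def)
  define t where "t = (\<lambda>n. u * real n powr (\<beta> - 1))"
  have t_lim: "filterlim t (at_right 0) sequentially" unfolding t_def by (rule scale_tendsto[OF u])
  \<comment> \<open>Half of the exponent makes the tail small and the other half keeps its series
    summable; the price is the bounded factor \<open>2 ^ l\<close>.\<close>
  have "filterlim (\<lambda>s::real. s / 2) (at_right 0) (at_right 0)" by real_asymp
  from filterlim_compose[OF filterlim_compose[OF abel_sum_limit this] t_lim]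
  have "((\<lambda>n. 2 ^ l * ((t n / 2) ^ l * abel_sum a (t n / 2))) \<longlongrightarrow> 2 ^ l * K) sequentially"
    by (intro tendsto_mult tendsto_const)
  hence half: "((\<lambda>n. t n ^ l * abel_sum a (t n / 2)) \<longlongrightarrow> 2 ^ l * K) sequentially"
    by (simp add: power_divide)
  have tail: "((\<lambda>n. exp (- (t n * \<epsilon> * real n / 2))) \<longlongrightarrow> 0) sequentially"
  proof -
    have "t n * \<epsilon> * real n / 2 = u * \<epsilon> / 2 * real n powr \<beta>" for n
      by (cases "n = 0") (simp_all add: t_def powr_diff)
    moreover have "((\<lambda>n. exp (- (u * \<epsilon> / 2 * real n powr \<beta>))) \<longlongrightarrow> 0) sequentially"
      using u \<epsilon> beta by real_asymp
    ultimately show ?thesis by (simp only:)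
  qed
  have "((\<lambda>n. x * (t n ^ l * abel_sum a (t n) - exp (- (t n * \<epsilon> * real n / 2)) * (t n ^ l * abel_sum a (t n / 2))))
      \<longlongrightarrow> x * (K - 0 * (2 ^ l * K))) sequentially"
    by (intro tendsto_mult tendsto_diff tendsto_const tail half filterlim_compose[OF abel_sum_limit] t_lim)
  hence "\<forall>\<^sub>F n in sequentially. u ^ l < x * (t n ^ l * abel_sum a (t n) - exp (- (t n * \<epsilon> * real n / 2)) * (t n ^ l * abel_sum a (t n / 2)))"
    using \<epsilon>(1) by (intro order_tendstoD) (auto simp: u_def)
  then obtain N where N: "\<And>n. n \<ge> N \<Longrightarrow>
      u ^ l < x * (t n ^ l * abel_sum a (t n) - exp (- (t n * \<epsilon> * real n / 2)) * (t n ^ l * abel_sum a (t n / 2)))"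
    by (auto simp: eventually_sequentially)
  define D where "D = Min ((\<lambda>k. h k * exp (- (c * real k powr \<beta>))) ` {..N})"
  have D0: "D > 0" unfolding D_def using h_pos by (subst Min_gr_iff) auto
  have "D * exp (c * real n powr \<beta>) \<le> h n" for n
  proof (induction n rule: less_induct)
    case (less n)
    show ?case
    proof (cases "n \<le> N")
      case True
      have "D \<le> h n * exp (- (c * real n powr \<beta>))" unfolding D_def using True by (intro Min_le) auto
      thus ?thesis by (simp add: exp_minus field_simps)
    next
      case False
      hence n: "n > 0" "n \<ge> N" by auto
      let ?E = "exp (c * real n powr \<beta>)" and ?T = "{k \<in> {1..n}. real k \<le> \<epsilon> * real n}"
      let ?tail = "exp (- (t n * \<epsilon> * real n / 2))"
      have tpos: "t n > 0" using n u by (simp add: t_def)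
      have "D * ?E * exp (- t n * real k) \<le> h (n - k)" if k: "k \<in> ?T" for k
      proof -
        have "real k \<le> \<epsilon> * real n" using k by simp
        also have "\<dots> < real n" using \<epsilon> n by simp
        finally have kn: "k < n" by simp
        let ?y = "real (n - k)"
        have y: "?y > 0" "?y = real n - real k" using kn by auto
        have yn: "?y \<ge> (1 - \<epsilon>) * real n" using k unfolding y(2) by (simp add: algebra_simps)
        have "?y powr (\<beta> - 1) \<le> ((1 - \<epsilon>) * real n) powr (\<beta> - 1)"
          using yn n \<epsilon> beta by (intro powr_mono2') auto
        also have "\<dots> = (1 - \<epsilon>) powr (\<beta> - 1) * real n powr (\<beta> - 1)"
          using \<epsilon> by (simp add: powr_mult)
        also have "(1 - \<epsilon>) powr (\<beta> - 1) \<le> (1 - \<epsilon>) powr (- 1)"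
          using \<epsilon> beta by (intro powr_mono') auto
        also have "(1 - \<epsilon>) powr (- 1) = 1 / (1 - \<epsilon>)" using \<epsilon> by (simp add: powr_minus divide_inverse)
        finally have ypow: "?y powr (\<beta> - 1) \<le> 1 / (1 - \<epsilon>) * real n powr (\<beta> - 1)"
          by (simp add: mult_right_mono)
        \<comment> \<open>The tangent is taken at \<open>n - k\<close> instead of \<open>n\<close>,
          since \<open>n\<close> powers must now be bounded from above. Its steeper slope is what
          \<open>ypow\<close> controls.\<close>
        have "real n powr \<beta> \<le> ?y powr \<beta> + \<beta> * ?y powr (\<beta> - 1) * (real n - ?y)"
          using y beta by (intro powr_le_tangent) auto
        also have "\<dots> \<le> ?y powr \<beta> + \<beta> * (1 / (1 - \<epsilon>) * real n powr (\<beta> - 1)) * (real n - ?y)"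
          using ypow beta y by (intro add_left_mono mult_right_mono mult_left_mono) auto
        finally have "c * real n powr \<beta> \<le> c * (?y powr \<beta> + \<beta> * (1 / (1 - \<epsilon>) * real n powr (\<beta> - 1)) * (real n - ?y))"
          using c by (intro mult_left_mono) auto
        also have "\<dots> = c * ?y powr \<beta> + t n * real k"
          using y(2) by (simp add: t_def u_def algebra_simps)
        finally have "?E * exp (- t n * real k) \<le> exp (c * ?y powr \<beta>)"
          by (simp add: exp_add[symmetric])
        hence "D * (?E * exp (- t n * real k)) \<le> D * exp (c * ?y powr \<beta>)"
          using D0 by (intro mult_left_mono) auto
        also have "\<dots> \<le> h (n - k)" using less.IH[of "n - k"] k n by auto
        finally show ?thesis by (simp add: mult_ac)
      qed
      hence "(\<Sum>k\<in>?T. a k * (D * ?E * exp (- t n * real k))) \<le> (\<Sum>k\<in>?T. a k * h (n - k))"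
        by (intro sum_mono mult_left_mono a_nonneg)
      also have "\<dots> \<le> (\<Sum>k=1..n. a k * h (n - k))"
        using a_nonneg h_pos by (intro sum_mono2) (auto intro: mult_nonneg_nonneg less_imp_le)
      finally have "D * ?E * (\<Sum>k\<in>?T. a k * exp (- t n * real k)) \<le> (\<Sum>k=1..n. a k * h (n - k))"
        by (simp add: sum_distrib_left mult_ac)
      hence "x * (D * ?E * (\<Sum>k\<in>?T. a k * exp (- t n * real k))) \<le> real n * h n"
        unfolding rec[OF n(1)] using x by (intro mult_left_mono) auto
      moreover have "real n \<le> x * (\<Sum>k\<in>?T. a k * exp (- t n * real k))"
      proof -
        have t2: "t n / 2 > 0" using tpos by simp
        have "abel_sum a (t n) \<le> (\<Sum>k\<in>?T. a k * exp (- t n * real k)) + ?tail * abel_sum a (t n / 2)"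
        proof -
          have "(\<lambda>k. if k \<in> ?T then a k * exp (- t n * real k) else 0) sums (\<Sum>k\<in>?T. a k * exp (- t n * real k))"
            by (rule sums_If_finite_set) simp
          from sums_add[OF this sums_mult[OF summable_sums[OF abel_sum_summable[OF t2]], of ?tail]]
          have S: "(\<lambda>k. (if k \<in> ?T then a k * exp (- t n * real k) else 0) + ?tail * (a k * exp (- (t n / 2) * real k)))
             sums ((\<Sum>k\<in>?T. a k * exp (- t n * real k)) + ?tail * abel_sum a (t n / 2))"
            unfolding abel_sum_def .
          show ?thesis
            unfolding abel_sum_def[of a "t n"]
          proof (rule sums_le[OF _ summable_sums[OF abel_sum_summable[OF tpos]] S])
            fix k
            show "a k * exp (- t n * real k) \<le> (if k \<in> ?T then a k * exp (- t n * real k) else 0) +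
                ?tail * (a k * exp (- (t n / 2) * real k))"
            proof (cases "k \<in> ?T")
              case True thus ?thesis using a_nonneg[of k] by simp
            next
              case F: False
              show ?thesis
              proof (cases "k = 0")
                case True
                \<comment> \<open>The index 0 lies outside \<open>?T\<close> without being large;
                  its term vanishes because regularity includes \<open>a 0 = 0\<close>.\<close>
                thus ?thesis using reg by (simp add: abel_regular_def)
              next
                case False
                have "\<epsilon> * real n \<le> real k"
                proof (cases "k \<le> n")
                  case True
                  thus ?thesis using F False by auto
                next
                  case False
                  have "\<epsilon> * real n \<le> 1 * real n" using \<epsilon> by (intro mult_right_mono) auto
                  thus ?thesis using False by linarith
                qed
                hence "t n / 2 * (\<epsilon> * real n) \<le> t n / 2 * real k" using tpos by (intro mult_left_mono) auto
                hence "exp (- t n * real k) \<le> exp (- (t n * \<epsilon> * real n / 2) + - (t n / 2) * real k)"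
                  by (simp add: algebra_simps)
                also have "\<dots> = ?tail * exp (- (t n / 2) * real k)" by (rule exp_add)
                finally have "a k * exp (- t n * real k) \<le> a k * (?tail * exp (- (t n / 2) * real k))"
                  by (rule mult_left_mono) (rule a_nonneg)
                thus ?thesis unfolding if_not_P[OF F] by (simp only: mult.left_commute add_0)
              qed
            qed
          qed
        qed
        hence "x * (t n ^ l * abel_sum a (t n) - ?tail * (t n ^ l * abel_sum a (t n / 2))) \<le>
            t n ^ l * (x * (\<Sum>k\<in>?T. a k * exp (- t n * real k)))"
        proof -
          assume le: "abel_sum a (t n) \<le> (\<Sum>k\<in>?T. a k * exp (- t n * real k)) + ?tail * abel_sum a (t n / 2)"
          have "(x * t n ^ l) * (abel_sum a (t n) - ?tail * abel_sum a (t n / 2)) \<le>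
              (x * t n ^ l) * (\<Sum>k\<in>?T. a k * exp (- t n * real k))"
            using le x tpos by (intro mult_left_mono) auto
          thus ?thesis by (simp add: algebra_simps)
        qed
        hence "t n ^ l * real n \<le> t n ^ l * (x * (\<Sum>k\<in>?T. a k * exp (- t n * real k)))"
          using N[OF n(2)] scale_power[OF n(1), of u] by (simp add: t_def)
        thus ?thesis using tpos by (simp add: mult_le_cancel_left)
      qed
      hence "D * ?E * real n \<le> D * ?E * (x * (\<Sum>k\<in>?T. a k * exp (- t n * real k)))"
        using D0 by (intro mult_left_mono) auto
      ultimately have "real n * (D * ?E) \<le> real n * h n" by (simp add: mult_ac)
      thus ?thesis using n by simp
    qed
  qed
  thus ?thesis using D0 by blast
qed

text \<open>The map from \<open>c\<close> to \<open>(c * \<beta>) ^ l\<close> is increasing on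
  positive \<open>c\<close> and takes the value \<open>x * K\<close> at \<open>b\<close>, so the two
  bounds hold for every \<open>c\<close> above and every positive \<open>c\<close> below
  \<open>b\<close>. The constants \<open>D\<close> disappear after division by
  \<open>real n powr \<beta>\<close>.\<close>

lemma ln_asymp:
  "(\<lambda>n. ln (h n)) \<sim>[at_top] (\<lambda>n. real l / (real l - 1) * (x * K) powr (1 / real l) * real n powr \<beta>)"
proof (rule asymp_equivI')
  define b where "b = real l / (real l - 1) * (x * K) powr (1 / real l)"
  have b: "b > 0" using l x K by (simp add: b_def)
  have b_pow: "(b * \<beta>) ^ l = x * K"
  proof -
    have "b * \<beta> = (x * K) powr (1 / real l)" using l by (simp add: b_def \<beta>_def)
    thus ?thesis using l x K by (simp add: powr_realpow[symmetric] powr_powr)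
  qed
  have lim: "((\<lambda>n. C / real n powr \<beta> + c) \<longlongrightarrow> c) sequentially" for C c :: real
    using beta by real_asymp
  have "((\<lambda>n. ln (h n) / real n powr \<beta>) \<longlongrightarrow> b) sequentially"
  proof (rule order_tendstoI)
    fix y assume "b < y"
    then obtain c where c: "b < c" "c < y" using dense by blast
    have "(b * \<beta>) ^ l < (c * \<beta>) ^ l" using c b beta l by (intro power_strict_mono) auto
    then obtain D where D: "\<And>n. h n \<le> D * exp (c * real n powr \<beta>)"
      using upper_bound[of c] b c b_pow by auto
    have D0: "D > 0" using D[of 0] h_pos[of 0] beta by simp
    show "\<forall>\<^sub>F n in sequentially. ln (h n) / real n powr \<beta> < y"
      using order_tendstoD(2)[OF lim[of "ln D" c] c(2)] eventually_gt_at_top[of 0]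
    proof eventually_elim
      case (elim n)
      have "ln (h n) \<le> ln (D * exp (c * real n powr \<beta>))" using D[of n] h_pos[of n] by simp
      also have "\<dots> = ln D + c * real n powr \<beta>" using D0 by (simp add: ln_mult)
      finally have "ln (h n) / real n powr \<beta> \<le> (ln D + c * real n powr \<beta>) / real n powr \<beta>"
        by (rule divide_right_mono) simp
      hence "ln (h n) / real n powr \<beta> \<le> ln D / real n powr \<beta> + c"
        using elim by (simp add: add_divide_distrib)
      thus ?case using elim by simp
    qed
  next
    fix y assume "y < b"
    \<comment> \<open>The lower bound requires \<open>c > 0\<close>, while \<open>y\<close> may be
      negative.\<close>
    then obtain c where c: "max y 0 < c" "c < b" using dense[of "max y 0" b] b by auto
    have "(c * \<beta>) ^ l < (b * \<beta>) ^ l" using c b beta l by (intro power_strict_mono) auto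
    then obtain D where D0: "D > 0" and D: "\<And>n. D * exp (c * real n powr \<beta>) \<le> h n"
      using lower_bound[of c] c b_pow by auto
    have "y < c" using c by simp
    show "\<forall>\<^sub>F n in sequentially. y < ln (h n) / real n powr \<beta>"
      using order_tendstoD(1)[OF lim[of "ln D" c] \<open>y < c\<close>] eventually_gt_at_top[of 0]
    proof eventually_elim
      case (elim n)
      have "ln D + c * real n powr \<beta> = ln (D * exp (c * real n powr \<beta>))" using D0 by (simp add: ln_mult)
      also have "\<dots> \<le> ln (h n)" using D[of n] D0 h_pos[of n] by simp
      finally have "(ln D + c * real n powr \<beta>) / real n powr \<beta> \<le> ln (h n) / real n powr \<beta>"
        by (rule divide_right_mono) simp
      hence "ln D / real n powr \<beta> + c \<le> ln (h n) / real n powr \<beta>"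
        using elim by (simp add: add_divide_distrib)
      thus ?case using elim by simp
    qed
  qed
  hence "((\<lambda>n. ln (h n) / real n powr \<beta> / b) \<longlongrightarrow> b / b) sequentially"
    by (intro tendsto_divide tendsto_const) (use b in auto)
  thus "((\<lambda>n. ln (h n) / (real l / (real l - 1) * (x * K) powr (1 / real l) * real n powr \<beta>)) \<longlongrightarrow> 1) sequentially"
    using b unfolding b_def[symmetric] by (simp add: mult_ac)
qed

end

text \<open>This keeps the term \<open>k = 1\<close> of the recurrence positive, which makes every
  \<open>weighted_count\<close> positive and its logarithm meaningful.\<close>

lemma num_subgroups_one: "num_subgroups l 1 = 1"
  by (induction l) auto

lemma weighted_count_pos:
  assumes "x > 0"
  shows "weighted_count x l n > 0"
proof (induction n rule: less_induct)
  case (less n)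
  show ?case
  proof (cases "n = 0")
    case False
    have "0 < (\<Sum>k=1..n. real (num_subgroups l k) * weighted_count x l (n - k))"
    proof (rule sum_pos2[where i = 1])
      show "0 < real (num_subgroups l 1) * weighted_count x l (n - 1)"
        using less False num_subgroups_one[of l] by simp
      show "0 \<le> real (num_subgroups l k) * weighted_count x l (n - k)" if "k \<in> {1..n}" for k
        using less[of "n - k"] that by (simp add: less_imp_le)
    qed (use False in auto)
    thus ?thesis using assms False by (subst weighted_count.simps) simp
  qed (simp add: weighted_count.simps)
qed

theorem proposition1p2:
  fixes l :: nat and x :: real
  assumes "l \<ge> 2" and "x > 0"
  shows "(\<lambda>n::nat. ln (orbit_poly l n x)) \<sim>[at_top]
         (\<lambda>n. real l / (real l - 1) * (x * K_const l) powr (1 / real l)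
                * real n powr ((real l - 1) / real l))"
proof -
  have K: "K_const l > 0"
  proof -
    have "riemann_zeta (real i) > 0" if i: "i \<in> {2..l}" for i
    proof -
      have eq: "1 / real (Suc m) powr real i = 1 / real (Suc m) ^ i" for m
        by (simp add: powr_realpow del: of_nat_Suc)
      have "summable (\<lambda>m. 1 / real (Suc m) ^ i)"
        using inverse_power_summable[of i, where ?'a = real] i
        by (subst summable_Suc_iff[of "\<lambda>n. 1 / real n ^ i"]) (simp_all add: inverse_eq_divide)
      thus ?thesis unfolding riemann_zeta_def eq by (rule suminf_pos) simp
    qed
    thus ?thesis unfolding K_const_def by (intro mult_pos_pos prod_pos) auto
  qed
  have "abel_regular (\<lambda>k. real (num_subgroups l k)) l (K_const l)"
    \<comment> \<open>Weight \<open>j = 0\<close>; the shift to \<open>l - 1\<close> also produces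
      the factorial in \<open>K_const\<close>.\<close>
    using abel_regular_num_subgroups[of 0 "l - 1"] assms(1)
    by (simp add: K_const_def del: num_subgroups.simps)
  moreover have "real n * weighted_count x l n =
      x * (\<Sum>k=1..n. real (num_subgroups l k) * weighted_count x l (n - k))" if "n > 0" for n
    using that by (subst weighted_count.simps) simp
  ultimately interpret convolution_recurrence "\<lambda>k. real (num_subgroups l k)" "weighted_count x l" x "K_const l" l
    using K assms weighted_count_pos by unfold_locales auto
  show ?thesis using ln_asymp by (simp add: \<beta>_def orbit_poly_eq_weighted_count)
qed

end
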